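(* Let $\mathcal G$ be the group of interval exchange transformations of $[0,1)$. If $\mathcal G$ has partial uniform perfectness, then $\mathcal G$ is uniformly perfect.
   Context: Let $I=[0,1)$. An interval exchange transformation (IET) of $I$ is a right-continuous bijection $f:I\to I$ defined by a finite partition of $I$ into half-open subintervals $[a_i,a_{i+1})$ and a reordering of these intervals by translations. $\mathcal G$ is the group of all IET of $I$ under composition. By convention every IET is considered discontinuous at the left endpoint $0$; $BP(f)$ denotes the set of discontinuity points of $f$ (including $0$). For a group $G$, a commutator is an element $[f,g]=fgf^{-1}g^{-1}$ with $f,g\in G$, and $[G,G]$ is the subgroup generated by commutators. For $g\in[G,G]$, the commutator length $c_G(g)$ is the least number $c$ such that $g$ is a product of $c$ commutators of $G$, and $c(G)=\sup\{c_G(g): g\in[G,G]\}$. In this convention, $G$ is called uniformly perfect if $c(G)$ is finite (it is not required that $G=[G,G]$). For a positive integer $p$ and $\alpha=(\alpha_1,\dots,\alpha_p)\in[0,1)^p$, let $\Delta_\alpha$ be the additive subgroup of $\mathbb R$ generated by $\alpha_1,\dots,\alpha_p$ and $1$, and let $\Gamma_\alpha=\{g\in\mathcal G: BP(g)\subset\Delta_\alpha\}$. The group $\mathcal G$ has partial uniform perfectness if for every positive integer $p$ and every $\alpha\in[0,1)^p$ the quantity $C_\alpha(\mathcal G):=\sup\{c_{\mathcal G}(g): g\in[\mathcal G,\mathcal G]\cap\Gamma_\alpha\}$ is finite. *)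

theory Defs
  imports
    Complex_Main
    "HOL-Library.Extended_Nat"
    "HOL-Computational_Algebra.Group_Closure"
    "HOL-Algebra.Bij"
    "HOL-Algebra.Generated_Groups"
begin

abbreviation unit_interval :: "real set" where
  "unit_interval \<equiv> {0..<1}"

(* Elements of Bij are extensional, i.e. undefined outside [0,1), so that equality of
   functions is equality on [0,1). Being a bijection of [0,1) that is a translation on
   every piece [a i, a (i+1)) amounts to reordering the pieces by translations. *)
definition iet :: "(real \<Rightarrow> real) set" where
  "iet = {f \<in> Bij unit_interval. \<exists>(n::nat) (a::nat \<Rightarrow> real).
            a 0 = 0 \<and> a n = 1 \<and> (\<forall>i<n. a i < a (Suc i)) \<and>
            (\<forall>i<n. \<exists>c. \<forall>x\<in>{a i..<a (Suc i)}. f x = x + c)}"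

lemma iet_right_continuous:
  assumes "f \<in> iet" and "x \<in> unit_interval"
  shows "continuous (at_right x) f"
proof -
  obtain n :: nat and a :: "nat \<Rightarrow> real" where a: "a 0 = 0" "a n = 1"
    and tr: "\<forall>i<n. \<exists>c. \<forall>x\<in>{a i..<a (Suc i)}. f x = x + c"
    using assms(1) unfolding iet_def by blast
  have "\<exists>i<m. a i \<le> x \<and> x < a (Suc i)" if "x < a m" for m :: nat
    using that
  proof (induction m)
    case 0
    then show ?case using a assms(2) by simp
  next
    case (Suc m)
    then show ?case by (cases "x < a m") (auto intro: less_SucI)
  qed
  from this[of n] obtain i where i: "i < n" "a i \<le> x" "x < a (Suc i)"
    using a assms(2) by auto
  then obtain c where c: "\<forall>y\<in>{a i..<a (Suc i)}. f y = y + c" using tr by blast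
  have "eventually (\<lambda>y. y + c = f y) (at_right x)"
    unfolding eventually_at_right_field using c i by (intro exI[of _ "a (Suc i)"]) auto
  moreover have "((\<lambda>y. y + c) \<longlongrightarrow> x + c) (at_right x)"
    by (intro tendsto_intros)
  ultimately have "(f \<longlongrightarrow> x + c) (at_right x)"
    using tendsto_cong by force
  then show ?thesis using c i by (simp add: continuous_within)
qed

definition iet_group :: "(real \<Rightarrow> real) monoid" where
  "iet_group = BijGroup unit_interval \<lparr>carrier := iet\<rparr>"

(* An IET is right-continuous at 0, hence continuous there relative to [0,1);
   the point 0 is included by convention. *)
definition BP :: "(real \<Rightarrow> real) \<Rightarrow> real set" where
  "BP f = insert 0 {x \<in> unit_interval. \<not> continuous (at x within unit_interval) f}"

definition product_of_commutators :: "('a, 'b) monoid_scheme \<Rightarrow> nat \<Rightarrow> 'a \<Rightarrow> bool" where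
  "product_of_commutators G c g \<longleftrightarrow>
     (\<exists>ks. length ks = c \<and> set ks \<subseteq> derived_set G (carrier G) \<and>
           g = foldr (\<lambda>x y. x \<otimes>\<^bsub>G\<^esub> y) ks \<one>\<^bsub>G\<^esub>)"

definition commutator_length :: "('a, 'b) monoid_scheme \<Rightarrow> 'a \<Rightarrow> nat" where
  "commutator_length G g = (LEAST c. product_of_commutators G c g)"

definition commutator_width :: "('a, 'b) monoid_scheme \<Rightarrow> enat" where
  "commutator_width G = (SUP g \<in> derived G (carrier G). enat (commutator_length G g))"

(* It is not required that G be perfect. *)
definition uniformly_perfect :: "('a, 'b) monoid_scheme \<Rightarrow> bool" where
  "uniformly_perfect G \<longleftrightarrow> commutator_width G < \<infinity>"

(* A p-tuple alpha is represented by the values alpha 1, ..., alpha p. *)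
definition Delta :: "nat \<Rightarrow> (nat \<Rightarrow> real) \<Rightarrow> real set" where
  "Delta p \<alpha> = group_closure (insert 1 (\<alpha> ` {1..p}))"

definition Gamma :: "nat \<Rightarrow> (nat \<Rightarrow> real) \<Rightarrow> (real \<Rightarrow> real) set" where
  "Gamma p \<alpha> = {g \<in> carrier iet_group. BP g \<subseteq> Delta p \<alpha>}"

definition partial_commutator_width :: "nat \<Rightarrow> (nat \<Rightarrow> real) \<Rightarrow> enat" where
  "partial_commutator_width p \<alpha> =
     (SUP g \<in> derived iet_group (carrier iet_group) \<inter> Gamma p \<alpha>.
        enat (commutator_length iet_group g))"

definition iet_partial_uniform_perfectness :: bool where
  "iet_partial_uniform_perfectness \<longleftrightarrow>
     (\<forall>p\<ge>1. \<forall>\<alpha>. (\<forall>i\<in>{1..p}. \<alpha> i \<in> {0..<1}) \<longrightarrow> partial_commutator_width p \<alpha> < \<infinity>)"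

end

theory Submission
  imports Defs "HOL-Analysis.Analysis"
begin

text \<open>
  Every element \<open>g\<close> of the derived group is shown to be a product of three commutators.

  Fix \<open>g\<close> and let \<open>D\<close> be the additive subgroup of the reals generated by \<open>1\<close>, by \<open>sqrt 2\<close> (so that
  \<open>D\<close> is dense), and by the breakpoints and the translation lengths of \<open>g\<close>. It is finitely
  generated, so the hypothesis bounds by some \<open>C\<close> the commutator length of all elements of the derived
  group with breakpoints in \<open>D\<close>. The constant \<open>C\<close> depends on \<open>g\<close>; it is removed as follows. Let
  \<open>M = 2 ^ C > C\<close>.

  \<^item> As in Rokhlin's lemma there is a finite union \<open>J\<close> of intervals with endpoints in \<open>D\<close> such that
    \<open>J\<close> is disjoint from its images under \<open>g, \<dots>, g ^ (M - 1)\<close> and is met in bounded time by every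
    orbit that is not periodic of period less than \<open>M\<close>. If \<open>r\<close> is the first return map of \<open>g\<close> to
    \<open>J\<close>, extended by the identity, then \<open>g = r p\<close> with \<open>p\<close> of finite order
    (\<open>split_off_finite_order\<close>).
  \<^item> An exchange \<open>p\<close> of finite order is one commutator (\<open>finite_order_is_commutator\<close>). It permutes
    the cells of a partition; some \<open>w\<close> inverts \<open>p\<close> and interchanges the left halves of the cells
    with the right halves, and if \<open>p'\<close> is \<open>p\<close> on the left halves and the identity elsewhere, then
    \<open>p = p' w p'\<^sup>-\<^sup>1 w\<^sup>-\<^sup>1\<close>.
  \<^item> \<open>J\<close> has \<open>M\<close> disjoint images under powers of \<open>g\<close>, hence measure at most \<open>1 / M\<close>, and \<open>r\<close> is conjugate, with all
    breakpoints kept in \<open>D\<close>, to an exchange supported in \<open>[0, 1 / M)\<close>. The latter is the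
    \<open>1 / M\<close>-scale copy of an exchange \<open>F\<close>. Since \<open>D\<close> is stable under multiplication by \<open>M\<close>, the
    breakpoints of \<open>F\<close> lie in \<open>D\<close> as well.
  \<^item> \<open>F\<close> belongs to the derived group (\<open>derived_of_shrink\<close>): the class in the abelianization of the
    exchange of two adjacent intervals is additive in both lengths, and these exchanges generate,
    so that the class of any exchange is \<open>4\<close> times the class of its half-scale copy. This is
    why \<open>M\<close> is taken to be a power of two.
  \<^item> Hence \<open>F\<close> is a product of at most \<open>C < M\<close> commutators. Because there are \<open>M\<close> blocks of length
    \<open>1 / M\<close> that can be permuted cyclically, the copy of \<open>F\<close> in the first block is a product of
    two commutators, whatever \<open>C\<close> is (\<open>first_block_two_commutators\<close>).
\<close>

section \<open>Step functions and piecewise translations with restricted breakpoints\<close>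

text \<open>The groups that contain the breakpoints. With \<open>D = UNIV\<close> there is no restriction, so that
  statements about unrestricted exchanges are instances of statements about \<open>D\<close>.\<close>

locale unit_subgroup =
  fixes D :: "real set"
  assumes one_mem: "1 \<in> D"
    and diff_mem: "a \<in> D \<Longrightarrow> b \<in> D \<Longrightarrow> a - b \<in> D"
begin

lemma zero_mem: "0 \<in> D"
  using diff_mem[OF one_mem one_mem] by simp

lemma minus_mem: "a \<in> D \<Longrightarrow> - a \<in> D"
  using diff_mem[OF zero_mem] by force

lemma add_mem: "a \<in> D \<Longrightarrow> b \<in> D \<Longrightarrow> a + b \<in> D"
  using diff_mem[OF _ minus_mem] by force

lemma of_nat_mult_mem: "a \<in> D \<Longrightarrow> of_nat n * a \<in> D"
  by (induction n) (auto simp: zero_mem add_mem distrib_right)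

end

text \<open>\<open>const_off E s\<close>: on \<open>[0, 1)\<close>, the function \<open>s\<close> can change its value only at points of \<open>E\<close>,
  and takes its new value at the point itself.\<close>

definition const_off :: "real set \<Rightarrow> (real \<Rightarrow> 'a) \<Rightarrow> bool" where
  "const_off E s \<longleftrightarrow>
     (\<forall>x y. 0 \<le> x \<and> x \<le> y \<and> y < 1 \<and> E \<inter> {x<..y} = {} \<longrightarrow> s x = s y)"

text \<open>Right-continuous step functions on \<open>[0, 1)\<close> with jumps in \<open>D\<close>. The values outside \<open>[0, 1)\<close> are
  ignored. Finite unions of intervals with endpoints in \<open>D\<close> are the sets whose membership predicate is
  a step function.\<close>

definition step_fun :: "real set \<Rightarrow> (real \<Rightarrow> 'a) \<Rightarrow> bool" where
  "step_fun D s \<longleftrightarrow> (\<exists>E. finite E \<and> E \<subseteq> D \<and> const_off E s)"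

text \<open>Interval exchanges with breakpoints and translation lengths in \<open>D\<close>, as total functions whose
  values outside \<open>[0, 1)\<close> are ignored. A partition is not part of the data: an exchange is a
  bijection whose displacement is a step function.\<close>

definition exchange :: "real set \<Rightarrow> (real \<Rightarrow> real) \<Rightarrow> bool" where
  "exchange D f \<longleftrightarrow> bij_betw f unit_interval unit_interval \<and>
     step_fun D (\<lambda>x. f x - x) \<and> (\<forall>x\<in>unit_interval. f x - x \<in> D)"

lemma const_offD:
  "const_off E s \<Longrightarrow> 0 \<le> x \<Longrightarrow> x \<le> y \<Longrightarrow> y < 1 \<Longrightarrow> E \<inter> {x<..y} = {} \<Longrightarrow> s x = s y"
  unfolding const_off_def by simp

lemma step_funI:
  assumes "finite E" "E \<subseteq> D"
    and "\<And>x y. 0 \<le> x \<Longrightarrow> x \<le> y \<Longrightarrow> y < 1 \<Longrightarrow> E \<inter> {x<..y} = {} \<Longrightarrow> s x = s y"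
  shows "step_fun D s"
  unfolding step_fun_def const_off_def using assms by (intro exI[of _ E]) simp

lemma step_funE:
  assumes "step_fun D s"
  obtains E where "finite E" "E \<subseteq> D" "const_off E s"
  using assms unfolding step_fun_def by blast

lemma exchangeD:
  assumes "exchange D f"
  shows "bij_betw f unit_interval unit_interval" "step_fun D (\<lambda>x. f x - x)"
    "x \<in> unit_interval \<Longrightarrow> f x - x \<in> D"
  using assms unfolding exchange_def by auto

lemma step_fun_mono: "step_fun D s \<Longrightarrow> D \<subseteq> D' \<Longrightarrow> step_fun D' s"
  unfolding step_fun_def by blast

lemma exchange_mono: "exchange D f \<Longrightarrow> D \<subseteq> D' \<Longrightarrow> exchange D' f"
  unfolding exchange_def using step_fun_mono by blast

text \<open>The closure properties of step functions are instances of one principle: a function that is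
  determined by finitely many step functions is a step function.\<close>

lemma step_fun_determined:
  assumes "finite A" "\<And>i. i \<in> A \<Longrightarrow> step_fun D (s i)"
    and det: "\<And>x y. x \<in> unit_interval \<Longrightarrow> y \<in> unit_interval \<Longrightarrow>
      (\<And>i. i \<in> A \<Longrightarrow> s i x = s i y) \<Longrightarrow> t x = t y"
  shows "step_fun D t"
proof -
  have "\<forall>i\<in>A. \<exists>E. finite E \<and> E \<subseteq> D \<and> const_off E (s i)"
    using assms(2) unfolding step_fun_def by blast
  then obtain E where E: "\<forall>i\<in>A. finite (E i) \<and> E i \<subseteq> D \<and> const_off (E i) (s i)"
    by metis
  show ?thesis
  proof (rule step_funI)
    show "finite (\<Union>i\<in>A. E i)" "(\<Union>i\<in>A. E i) \<subseteq> D" using E assms(1) by auto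
    fix x y :: real
    assume xy: "0 \<le> x" "x \<le> y" "y < 1" "(\<Union>i\<in>A. E i) \<inter> {x<..y} = {}"
    have "s i x = s i y" if "i \<in> A" for i
    proof -
      have "E i \<inter> {x<..y} = {}" using xy that by blast
      then show ?thesis using E that xy const_offD by metis
    qed
    then show "t x = t y" using det xy by simp
  qed
qed

lemma step_fun_const: "step_fun D (\<lambda>x. c)"
  by (rule step_funI[of "{}"]) auto

lemma step_fun_apply: "step_fun D s \<Longrightarrow> step_fun D (\<lambda>x. F (s x))"
  by (rule step_fun_determined[of "{()}" D "\<lambda>_. s"]) auto

lemma step_fun_apply2:
  assumes "step_fun D s" "step_fun D t"
  shows "step_fun D (\<lambda>x. F (s x) (t x))"
proof -
  obtain E where E: "finite E" "E \<subseteq> D"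
    "const_off E (\<lambda>x. s x)"
    using step_funE[OF assms(1)] by metis
  obtain E' where E': "finite E'" "E' \<subseteq> D"
    "const_off E' (\<lambda>x. t x)"
    using step_funE[OF assms(2)] by metis
  show ?thesis
  proof (rule step_funI[of "E \<union> E'"])
    fix x y :: real
    assume xy: "0 \<le> x" "x \<le> y" "y < 1" "(E \<union> E') \<inter> {x<..y} = {}"
    have "s x = s y" by (rule const_offD[OF E(3)]) (use xy in auto)
    moreover have "t x = t y" by (rule const_offD[OF E'(3)]) (use xy in auto)
    ultimately show "F (s x) (t x) = F (s y) (t y)" by simp
  qed (use E E' in auto)
qed

lemma step_fun_less: "c \<in> D \<Longrightarrow> step_fun D (\<lambda>x. x < c)"
  by (rule step_funI[of "{c}"]) force+

lemma step_fun_Ball: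
  assumes "finite A" "\<And>i. i \<in> A \<Longrightarrow> step_fun D (P i)"
  shows "step_fun D (\<lambda>x. \<forall>i\<in>A. P i x)"
  by (rule step_fun_determined[OF assms]) auto

text \<open>The left endpoint of the cell that contains \<open>x\<close> in the partition of \<open>[0, 1)\<close> by \<open>E\<close>.\<close>

lemma gap_start:
  fixes E :: "real set"
  assumes "finite E" "x \<in> unit_interval"
  obtains e where "e \<in> insert 0 (E \<inter> unit_interval)" "e \<le> x" "E \<inter> {e<..x} = {}"
proof -
  let ?S = "{e \<in> insert 0 (E \<inter> unit_interval). e \<le> x}"
  have S: "finite ?S" "0 \<in> ?S" using assms by auto
  have "Max ?S \<in> ?S" by (rule Max_in) (use S in auto)
  moreover have "E \<inter> {Max ?S<..x} = {}"
  proof -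
    have "e \<le> Max ?S" if "e \<in> E" "e \<le> x" "e > Max ?S" for e
    proof -
      have "0 \<le> Max ?S" using S by simp
      then have "e \<in> ?S" using that assms by auto
      then show ?thesis using S by simp
    qed
    then show ?thesis by force
  qed
  ultimately show ?thesis using that by blast
qed

lemma step_fun_finite_range:
  assumes "step_fun D s"
  shows "finite (s ` unit_interval)"
proof -
  obtain E where E: "finite E" "E \<subseteq> D"
    "const_off E (\<lambda>x. s x)"
    using step_funE[OF assms] by metis
  have "s x \<in> s ` insert 0 (E \<inter> unit_interval)" if x: "x \<in> unit_interval" for x
  proof -
    obtain e where "e \<in> insert 0 (E \<inter> unit_interval)" "e \<le> x" "E \<inter> {e<..x} = {}"
      using gap_start[OF E(1) x] .
    then have "s e = s x" using const_offD[OF E(3), of e x] x by auto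
    then show ?thesis using \<open>e \<in> _\<close> by (metis imageI)
  qed
  then have "s ` unit_interval \<subseteq> s ` insert 0 (E \<inter> unit_interval)" by blast
  then show ?thesis by (rule finite_subset) (use E(1) in simp)
qed

lemma exchange_mem: "exchange D f \<Longrightarrow> x \<in> unit_interval \<Longrightarrow> f x \<in> unit_interval"
  using bij_betwE[OF exchangeD(1)] by blast

lemma exchange_inj:
  "exchange D f \<Longrightarrow> x \<in> unit_interval \<Longrightarrow> y \<in> unit_interval \<Longrightarrow> f x = f y \<Longrightarrow> x = y"
  using bij_betw_imp_inj_on[OF exchangeD(1)] by (rule inj_onD)

lemma exchange_surj:
  assumes "exchange D f" "y \<in> unit_interval"
  obtains x where "x \<in> unit_interval" "f x = y"
proof -
  have "y \<in> f ` unit_interval"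
    using bij_betw_imp_surj_on[OF exchangeD(1)[OF assms(1)]] assms(2) by simp
  then show ?thesis using that by (elim imageE) simp
qed

lemma exchange_cong:
  assumes "exchange D f" "\<And>x. x \<in> unit_interval \<Longrightarrow> f x = g x"
  shows "exchange D g"
proof -
  have "step_fun D (\<lambda>x. g x - x)"
    by (rule step_fun_determined[of "{()}" D "\<lambda>_ x. f x - x"])
      (use assms in \<open>auto simp: exchange_def\<close>)
  then show ?thesis using assms bij_betw_cong[of unit_interval f g] unfolding exchange_def by simp
qed

context unit_subgroup
begin

lemma exchange_id: "exchange D (\<lambda>x. x)"
  unfolding exchange_def by (simp add: bij_betw_def inj_on_def zero_mem step_fun_const)

lemma exchange_mem_D: "exchange D f \<Longrightarrow> x \<in> unit_interval \<Longrightarrow> x \<in> D \<Longrightarrow> f x \<in> D"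
  unfolding exchange_def using add_mem[of "f x - x" x] by simp

lemma step_fun_compose:
  assumes "exchange D g" "step_fun D s"
  shows "step_fun D (\<lambda>x. s (g x))"
proof -
  obtain E where E: "finite E" "E \<subseteq> D"
    "const_off E (\<lambda>x. g x - x)"
    using step_funE[OF exchangeD(2)[OF assms(1)]] by metis
  obtain E' where E': "finite E'" "E' \<subseteq> D"
    "const_off E' (\<lambda>x. s x)"
    using step_funE[OF assms(2)] by metis
  let ?F = "{z \<in> unit_interval. g z \<in> E'}"
  show ?thesis
  proof (rule step_funI[of "E \<union> ?F"])
    have "inj_on g unit_interval" using assms(1) unfolding exchange_def bij_betw_def by blast
    then have "finite (unit_interval \<inter> g -` E')"
      using E'(1) by (metis finite_vimage_IntI inf_commute)
    moreover have "unit_interval \<inter> g -` E' = ?F" by blast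
    ultimately show "finite (E \<union> ?F)" using E(1) by simp
    have "z \<in> D" if "z \<in> ?F" for z
    proof -
      have "g z - z \<in> D" "g z \<in> D" using that assms(1) E'(2) unfolding exchange_def by auto
      then show ?thesis using diff_mem[of "g z" "g z - z"] by simp
    qed
    then show "E \<union> ?F \<subseteq> D" using E(2) by blast
    fix x y :: real
    assume xy: "0 \<le> x" "x \<le> y" "y < 1" "(E \<union> ?F) \<inter> {x<..y} = {}"
    have d: "g z - z = g x - x" if "x \<le> z" "z \<le> y" for z
    proof -
      have "E \<inter> {x<..z} = {}" using xy that by auto
      then show ?thesis using const_offD[OF E(3), of x z] that xy by simp
    qed
    \<comment> \<open>\<open>g\<close> is a translation on \<open>[x, y]\<close>, so a jump of \<open>s\<close> in \<open>(g x, g y]\<close> comes from a point of \<open>(x, y]\<close>.\<close>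
    have "E' \<inter> {g x<..g y} = {}"
    proof (rule ccontr)
      assume "\<not> ?thesis"
      then obtain e where e: "e \<in> E'" "g x < e" "e \<le> g y" by auto
      let ?z = "x + (e - g x)"
      have z: "x < ?z" "?z \<le> y" using e d[of y] xy by auto
      then have "g ?z = e" using d[of ?z] by simp
      then have "?z \<in> ?F" using z e xy by auto
      then have "?z \<in> (E \<union> ?F) \<inter> {x<..y}" using z by simp
      then show False using xy by blast
    qed
    then show "s (g x) = s (g y)"
      using const_offD[OF E'(3), of "g x" "g y"] d[of y] xy exchange_mem[OF assms(1)] by auto
  qed
qed

lemma exchange_compose:
  assumes "exchange D f" "exchange D g"
  shows "exchange D (\<lambda>x. f (g x))"
  unfolding exchange_def
proof (intro conjI ballI)
  show "bij_betw (\<lambda>x. f (g x)) unit_interval unit_interval"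
    using bij_betw_trans[OF exchangeD(1)[OF assms(2)] exchangeD(1)[OF assms(1)]]
    by (simp add: comp_def)
  have "step_fun D (\<lambda>x. (f (g x) - g x) + (g x - x))"
    by (intro step_fun_apply2[where F = "(+)"] step_fun_compose[OF assms(2) exchangeD(2)[OF assms(1)]]
        exchangeD(2)[OF assms(2)])
  then show "step_fun D (\<lambda>x. f (g x) - x)" by simp
  fix x assume "x \<in> unit_interval"
  then have "f (g x) - g x \<in> D" "g x - x \<in> D"
    using exchangeD(3)[OF assms(1), of "g x"] exchangeD(3)[OF assms(2), of x] exchange_mem[OF assms(2), of x]
    by simp_all
  from add_mem[OF this] show "f (g x) - x \<in> D" by simp
qed

lemma exchange_funpow: "exchange D f \<Longrightarrow> exchange D (f ^^ n)"
  by (induction n) (auto simp: exchange_id exchange_compose comp_def id_def)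

lemma exchange_inverse:
  assumes f: "exchange D f"
    and h: "\<And>x. x \<in> unit_interval \<Longrightarrow> h x \<in> unit_interval"
      "\<And>x. x \<in> unit_interval \<Longrightarrow> f (h x) = x"
  shows "exchange D h"
proof -
  obtain E where E: "finite E" "E \<subseteq> D"
    "const_off E (\<lambda>x. f x - x)"
    using step_funE[OF exchangeD(2)[OF f]] by metis
  have hf: "h (f x) = x" if "x \<in> unit_interval" for x
    using that h exchange_inj[OF f] exchange_mem[OF f] by blast
  let ?E = "f ` insert 0 (E \<inter> unit_interval)"
  have "step_fun D (\<lambda>x. h x - x)"
  proof (rule step_funI[of ?E])
    show "finite ?E" using E by simp
    show "?E \<subseteq> D"
    proof (rule image_subsetI)
      fix e assume "e \<in> insert 0 (E \<inter> unit_interval)"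
      then have "e \<in> unit_interval" "e \<in> D" using E(2) zero_mem by auto
      then show "f e \<in> D" by (rule exchange_mem_D[OF f])
    qed
    fix x y :: real
    assume xy: "0 \<le> x" "x \<le> y" "y < 1" "?E \<inter> {x<..y} = {}"
    have hy: "h y \<in> unit_interval" "f (h y) = y" using h xy by auto
    obtain e where e: "e \<in> insert 0 (E \<inter> unit_interval)" "e \<le> h y" "E \<inter> {e<..h y} = {}"
      using gap_start[OF E(1) hy(1)] .
    have eI: "0 \<le> e" using e by auto
    have d: "f z - z = f e - e" if "e \<le> z" "z \<le> h y" for z
    proof -
      have "E \<inter> {e<..z} = {}" using e that by auto
      then show ?thesis using const_offD[OF E(3), of e z] that hy eI by auto
    qed
    have "f e \<le> y" using d[of "h y"] e hy by simp
    then have fe: "f e \<le> x" using xy e by force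
    \<comment> \<open>\<open>f\<close> is a translation on \<open>[e, h y]\<close>, whose image contains \<open>[x, y]\<close>.\<close>
    let ?z = "e + (x - f e)"
    have z: "e \<le> ?z" "?z \<le> h y" using fe d[of "h y"] e hy xy by auto
    then have "f ?z = x" using d[of ?z] by simp
    then have "h x = ?z" using hf[of ?z] z hy eI by auto
    then show "h x - x = h y - y" using d[of "h y"] e hy by simp
  qed
  moreover have "bij_betw h unit_interval unit_interval"
    by (rule bij_betwI[where g = f]) (use h hf exchange_mem[OF f] in auto)
  moreover have "h x - x \<in> D" if "x \<in> unit_interval" for x
  proof -
    have "f (h x) - h x \<in> D" using h that f unfolding exchange_def by blast
    then show ?thesis using minus_mem[of "x - h x"] h that by simp
  qed
  ultimately show ?thesis unfolding exchange_def by blast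
qed

lemma exchange_inverse_exists:
  assumes f: "exchange D f"
  obtains h where "exchange D h" "\<And>x. x \<in> unit_interval \<Longrightarrow> f (h x) = x"
    "\<And>x. x \<in> unit_interval \<Longrightarrow> h (f x) = x"
proof -
  have b: "bij_betw f unit_interval unit_interval" using f unfolding exchange_def by blast
  let ?h = "inv_into unit_interval f"
  have "?h x \<in> unit_interval" "f (?h x) = x" if "x \<in> unit_interval" for x
    using that bij_betwE[OF bij_betw_inv_into[OF b]] bij_betw_inv_into_right[OF b] by auto
  then have "exchange D ?h" using exchange_inverse[OF f] by blast
  then show ?thesis
    using that[OF _ bij_betw_inv_into_right[OF b] bij_betw_inv_into_left[OF b]] by simp
qed

end

text \<open>The exchange of the adjacent intervals \<open>[u, u + a)\<close> and \<open>[u + a, u + a + b)\<close>.\<close>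

definition swap_intervals :: "real \<Rightarrow> real \<Rightarrow> real \<Rightarrow> real \<Rightarrow> real" where
  "swap_intervals u a b x =
     (if u \<le> x \<and> x < u + a then x + b
      else if u + a \<le> x \<and> x < u + a + b then x - a else x)"

lemma (in unit_subgroup) exchange_swap_intervals:
  assumes "u \<in> D" "a \<in> D" "b \<in> D" "0 \<le> u" "0 \<le> a" "0 \<le> b" "u + a + b \<le> 1"
  shows "exchange D (swap_intervals u a b)"
  unfolding exchange_def
proof (intro conjI ballI)
  show "bij_betw (swap_intervals u a b) unit_interval unit_interval"
    by (rule bij_betwI[where g = "swap_intervals u b a"])
      (use assms in \<open>auto simp: swap_intervals_def\<close>)
  show "step_fun D (\<lambda>x. swap_intervals u a b x - x)"
  proof (rule step_funI[of "{u, u + a, u + a + b}"])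
    fix x y :: real
    assume xy: "0 \<le> x" "x \<le> y" "y < 1" "{u, u + a, u + a + b} \<inter> {x<..y} = {}"
    then have "(u \<le> x \<longleftrightarrow> u \<le> y)" "(u + a \<le> x \<longleftrightarrow> u + a \<le> y)"
      "(u + a + b \<le> x \<longleftrightarrow> u + a + b \<le> y)" by auto
    then show "swap_intervals u a b x - x = swap_intervals u a b y - y"
      unfolding swap_intervals_def by auto
  qed (use assms add_mem in auto)
  fix x
  show "swap_intervals u a b x - x \<in> D"
    using assms zero_mem minus_mem by (auto simp: swap_intervals_def)
qed

section \<open>The group of interval exchange transformations\<close>

interpretation full: unit_subgroup UNIV
  by unfold_locales auto

lemma Bij_iff: "f \<in> Bij unit_interval \<longleftrightarrow>
    f \<in> extensional unit_interval \<and> bij_betw f unit_interval unit_interval"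
  by (auto simp: Bij_def)

lemma exchange_of_iet:
  assumes "f \<in> iet"
  shows "exchange UNIV f"
proof -
  obtain n :: nat and a :: "nat \<Rightarrow> real" where a: "a 0 = 0" "a n = 1"
    and tr: "\<forall>i<n. \<exists>c. \<forall>x\<in>{a i..<a (Suc i)}. f x = x + c"
    using assms unfolding iet_def by blast
  have "step_fun UNIV (\<lambda>x. f x - x)"
  proof (rule step_funI[of "a ` {..n}"])
    fix x y :: real
    assume xy: "0 \<le> x" "x \<le> y" "y < 1" "a ` {..n} \<inter> {x<..y} = {}"
    have "\<exists>i<m. a i \<le> x \<and> x < a (Suc i)" if "x < a m" for m :: nat
      using that
    proof (induction m)
      case 0
      then show ?case using a xy by simp
    next
      case (Suc m)
      then show ?case by (cases "x < a m") (auto intro: less_SucI)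
    qed
    from this[of n] obtain i where i: "i < n" "a i \<le> x" "x < a (Suc i)"
      using a xy by auto
    have "a (Suc i) \<in> a ` {..n}" using i by simp
    then have "a (Suc i) \<notin> {x<..y}" using xy(4) by blast
    then have "\<not> a (Suc i) \<le> y" using i by simp
    moreover obtain c where "\<forall>y\<in>{a i..<a (Suc i)}. f y = y + c" using tr i by blast
    ultimately show "f x - x = f y - y" using i xy by auto
  qed auto
  moreover have "bij_betw f unit_interval unit_interval"
    using assms unfolding iet_def Bij_iff by simp
  ultimately show ?thesis unfolding exchange_def by simp
qed

lemma iet_of_exchange:
  assumes f: "exchange UNIV f" and ext: "f \<in> extensional unit_interval"
  shows "f \<in> iet"
proof -
  obtain E where E: "finite E" "const_off E (\<lambda>x. f x - x)"
    using step_funE[OF exchangeD(2)[OF f]] by metis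
  define F where "F = insert 0 (insert 1 (E \<inter> unit_interval))"
  define l where "l = sorted_list_of_set F"
  have fin: "finite F" using E by (simp add: F_def)
  have l: "set l = F" "sorted_wrt (<) l"
    using fin by (simp_all add: l_def)
  have len: "length l > 0" using l(1) F_def by (cases l) auto
  have mono: "l ! i < l ! j" if "i < j" "j < length l" for i j
    using sorted_wrt_nth_less[OF l(2) that] .
  have ends: "l ! 0 = 0" "l ! (length l - 1) = 1"
  proof -
    have "0 \<in> set l" "1 \<in> set l" using l(1) unfolding F_def by auto
    then obtain i j where i: "i < length l" "l ! i = 0" and j: "j < length l" "l ! j = 1"
      by (auto simp: in_set_conv_nth)
    have "l ! 0 \<in> F" using nth_mem[of 0 l] l(1) len by simp
    then have "0 \<le> l ! 0" unfolding F_def by auto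
    then show "l ! 0 = 0" using mono[of 0 i] i by (cases i) auto
    have "l ! (length l - 1) \<in> F" using l(1) len by (metis nth_mem diff_less less_one)
    then have "l ! (length l - 1) \<le> 1" unfolding F_def by auto
    then show "l ! (length l - 1) = 1" using mono[of j "length l - 1"] j len
      by (cases j "length l - 1" rule: linorder_cases) auto
  qed
  have tr: "\<exists>c. \<forall>x\<in>{l ! i..<l ! Suc i}. f x = x + c" if i: "i < length l - 1" for i
  proof (intro exI ballI)
    fix x assume x: "x \<in> {l ! i..<l ! Suc i}"
    have "l ! i \<in> F" "l ! Suc i \<in> F" using nth_mem[of i l] nth_mem[of "Suc i" l] l(1) i by simp_all
    then have b: "0 \<le> l ! i" "l ! Suc i \<le> 1" unfolding F_def by auto
    have il: "i < length l" "Suc i < length l" using i by auto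
    have "E \<inter> {l ! i<..x} = {}"
    proof (rule ccontr)
      assume "\<not> ?thesis"
      then obtain e where e: "e \<in> E" "l ! i < e" "e \<le> x" by auto
      then have "e \<in> F" using x b unfolding F_def by auto
      then obtain j where j: "j < length l" "l ! j = e" using l(1) by (auto simp: in_set_conv_nth)
      have "i < j" using e j mono[of j i] il by (cases i j rule: linorder_cases) auto
      moreover have "j < Suc i" using e j x mono[of "Suc i" j] il
        by (cases "Suc i" j rule: linorder_cases) auto
      ultimately show False by simp
    qed
    then have "f (l ! i) - l ! i = f x - x"
      using const_offD[OF E(2), of "l ! i" x] x b by auto
    then show "f x = x + (f (l ! i) - l ! i)" by simp
  qed
  have "f \<in> Bij unit_interval" using ext exchangeD(1)[OF f] unfolding Bij_iff by simp
  moreover have "l ! i < l ! Suc i" if "i < length l - 1" for i using mono that by simp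
  ultimately show ?thesis using ends tr unfolding iet_def
    by (intro CollectI conjI exI[of _ "length l - 1"] exI[of _ "(!) l"]) auto
qed

text \<open>The element of the group that agrees with \<open>f\<close> on \<open>[0, 1)\<close>; group elements are undefined outside.\<close>

abbreviation iet_of :: "(real \<Rightarrow> real) \<Rightarrow> real \<Rightarrow> real" where
  "iet_of f \<equiv> restrict f unit_interval"

lemma iet_restrict:
  assumes "exchange UNIV f"
  shows "iet_of f \<in> iet"
  by (rule iet_of_exchange) (auto intro: exchange_cong[OF assms])

lemma restrict_iet: "f \<in> iet \<Longrightarrow> iet_of f = f"
  by (rule extensional_restrict) (simp add: iet_def Bij_iff)

lemma iet_ext:
  assumes "f \<in> iet" "g \<in> iet" "\<And>x. x \<in> unit_interval \<Longrightarrow> f x = g x"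
  shows "f = g"
  using restrict_ext[of unit_interval f g] assms(3) restrict_iet[OF assms(1)] restrict_iet[OF assms(2)]
  by simp

lemma iet_subgroup: "subgroup iet (BijGroup unit_interval)"
proof -
  interpret B: group "BijGroup unit_interval" by (rule group_BijGroup)
  have sub: "iet \<subseteq> Bij unit_interval" unfolding iet_def by blast
  show ?thesis
  proof (rule B.subgroupI)
    show "iet \<subseteq> carrier (BijGroup unit_interval)" using sub by (simp add: BijGroup_def)
    show "iet \<noteq> {}" using iet_restrict[OF full.exchange_id] by blast
    fix f assume f: "f \<in> iet"
    obtain h where h: "exchange UNIV h" "\<And>x. x \<in> unit_interval \<Longrightarrow> f (h x) = x"
      "\<And>x. x \<in> unit_interval \<Longrightarrow> h (f x) = x"
      using full.exchange_inverse_exists[OF exchange_of_iet[OF f]] by metis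
    have hI: "iet_of h \<in> iet" by (rule iet_restrict[OF h(1)])
    have "compose unit_interval (iet_of h) f = (\<lambda>x\<in>unit_interval. x)"
      unfolding compose_def
      by (intro restrict_ext) (simp only: restrict_apply exchange_mem[OF exchange_of_iet[OF f]] h(3) if_True)
    then have "iet_of h \<otimes>\<^bsub>BijGroup unit_interval\<^esub> f = \<one>\<^bsub>BijGroup unit_interval\<^esub>"
      using sub f hI by (auto simp: BijGroup_def)
    then have "inv\<^bsub>BijGroup unit_interval\<^esub> f = iet_of h"
      using sub f hI by (intro B.inv_equality) (auto simp: BijGroup_def)
    then show "inv\<^bsub>BijGroup unit_interval\<^esub> f \<in> iet" using hI by simp
    fix g assume g: "g \<in> iet"
    have "compose unit_interval f g \<in> iet"
      unfolding compose_def
      by (rule iet_restrict[OF full.exchange_compose[OF exchange_of_iet[OF f] exchange_of_iet[OF g]]])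
    then show "f \<otimes>\<^bsub>BijGroup unit_interval\<^esub> g \<in> iet"
      using sub f g by (auto simp: BijGroup_def)
  qed
qed

abbreviation (input) G where "G \<equiv> iet_group"

interpretation G: group iet_group
  unfolding iet_group_def
  by (rule group.subgroup_imp_group[OF group_BijGroup iet_subgroup])

lemma carrier_G [simp]: "carrier G = iet"
  by (simp add: iet_group_def)

lemma iet_closed [simp]:
  "\<one>\<^bsub>G\<^esub> \<in> iet"
  "f \<in> iet \<Longrightarrow> g \<in> iet \<Longrightarrow> f \<otimes>\<^bsub>G\<^esub> g \<in> iet"
  "f \<in> iet \<Longrightarrow> inv\<^bsub>G\<^esub> f \<in> iet"
  using G.one_closed G.m_closed G.inv_closed by simp_all

lemma mult_G: "f \<in> iet \<Longrightarrow> g \<in> iet \<Longrightarrow> f \<otimes>\<^bsub>G\<^esub> g = iet_of (\<lambda>x. f (g x))"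
  unfolding iet_group_def BijGroup_def by (auto simp: iet_def compose_def)

lemma mult_G_apply:
  "f \<in> iet \<Longrightarrow> g \<in> iet \<Longrightarrow> x \<in> unit_interval \<Longrightarrow> (f \<otimes>\<^bsub>G\<^esub> g) x = f (g x)"
  by (simp add: mult_G)

lemma one_G: "\<one>\<^bsub>G\<^esub> = iet_of (\<lambda>x. x)"
  by (simp add: iet_group_def BijGroup_def)

lemma one_G_apply: "x \<in> unit_interval \<Longrightarrow> \<one>\<^bsub>G\<^esub> x = x"
  by (simp add: one_G)

lemma iet_mem: "f \<in> iet \<Longrightarrow> x \<in> unit_interval \<Longrightarrow> f x \<in> unit_interval"
  by (rule exchange_mem[OF exchange_of_iet])

lemma mult_iet_of:
  assumes "exchange UNIV f" "exchange UNIV g"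
  shows "iet_of f \<otimes>\<^bsub>G\<^esub> iet_of g = iet_of (\<lambda>x. f (g x))"
  unfolding mult_G[OF iet_restrict[OF assms(1)] iet_restrict[OF assms(2)]]
  by (intro restrict_ext) (simp only: restrict_apply exchange_mem[OF assms(2)] if_True)

section \<open>Products of commutators\<close>

context group
begin

text \<open>The equation \<open>a b = g b a\<close> exhibits \<open>g\<close> as the commutator of \<open>a\<close> and \<open>b\<close>.\<close>

lemma commutatorI:
  assumes "a \<in> carrier G" "b \<in> carrier G" "g \<in> carrier G" "a \<otimes> b = g \<otimes> b \<otimes> a"
  shows "g \<in> derived_set G (carrier G)"
proof -
  have "a \<otimes> b \<otimes> inv a \<otimes> inv b = g \<otimes> b \<otimes> a \<otimes> inv a \<otimes> inv b" using assms by simp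
  also have "\<dots> = g" using assms by (simp add: m_assoc)
  finally have "g = a \<otimes> b \<otimes> inv a \<otimes> inv b" by simp
  then show ?thesis using assms by blast
qed

lemma inv_commutator:
  assumes "g \<in> derived_set G (carrier G)"
  shows "inv g \<in> derived_set G (carrier G)"
proof -
  obtain a b where ab: "a \<in> carrier G" "b \<in> carrier G" "g = a \<otimes> b \<otimes> inv a \<otimes> inv b"
    using assms by auto
  then have "inv g = b \<otimes> a \<otimes> inv b \<otimes> inv a" by (simp add: inv_mult_group m_assoc)
  then show ?thesis using ab by blast
qed

lemma conj_commutator:
  assumes "g \<in> derived_set G (carrier G)" "h \<in> carrier G"
  shows "h \<otimes> g \<otimes> inv h \<in> derived_set G (carrier G)"
proof -
  obtain a b where ab: "a \<in> carrier G" "b \<in> carrier G" "g = a \<otimes> b \<otimes> inv a \<otimes> inv b"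
    using assms by auto
  have c: "inv h \<otimes> (h \<otimes> x) = x" if "x \<in> carrier G" for x
    using assms that by (simp flip: m_assoc)
  have d: "inv a \<otimes> (a \<otimes> x) = x" "inv b \<otimes> (b \<otimes> x) = x" if "x \<in> carrier G" for x
    using ab that by (simp_all flip: m_assoc)
  show ?thesis
    by (rule commutatorI[of "h \<otimes> a \<otimes> inv h" "h \<otimes> b \<otimes> inv h"])
      (use ab assms in \<open>simp_all add: m_assoc c d\<close>)
qed

lemma foldr_mult_closed:
  "set ks \<subseteq> carrier G \<Longrightarrow> foldr (\<lambda>x y. x \<otimes> y) ks \<one> \<in> carrier G"
  by (induction ks) auto

lemma foldr_mult_append:
  assumes "set ks \<subseteq> carrier G" "set ls \<subseteq> carrier G"
  shows "foldr (\<lambda>x y. x \<otimes> y) (ks @ ls) \<one> =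
    foldr (\<lambda>x y. x \<otimes> y) ks \<one> \<otimes> foldr (\<lambda>x y. x \<otimes> y) ls \<one>"
  using assms by (induction ks) (auto simp: m_assoc foldr_mult_closed simp del: foldr_append)

lemma derived_set_carrier: "derived_set G (carrier G) \<subseteq> carrier G"
  by (rule derived_set_in_carrier) simp

lemma product_of_commutators_one:
  assumes "g \<in> derived_set G (carrier G)"
  shows "product_of_commutators G 1 g"
proof -
  have "g \<in> carrier G" by (rule subsetD[OF derived_set_carrier assms])
  then show ?thesis unfolding product_of_commutators_def
    using assms by (intro exI[of _ "[g]"]) simp
qed

lemma product_of_commutators_mult:
  assumes "product_of_commutators G m g" "product_of_commutators G n h"
  shows "product_of_commutators G (m + n) (g \<otimes> h)"
proof -
  obtain ks where ks: "length ks = m" "set ks \<subseteq> derived_set G (carrier G)"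
    "g = foldr (\<lambda>x y. x \<otimes> y) ks \<one>"
    using assms(1) unfolding product_of_commutators_def by blast
  obtain ls where ls: "length ls = n" "set ls \<subseteq> derived_set G (carrier G)"
    "h = foldr (\<lambda>x y. x \<otimes> y) ls \<one>"
    using assms(2) unfolding product_of_commutators_def by blast
  have "foldr (\<lambda>x y. x \<otimes> y) (ks @ ls) \<one> = g \<otimes> h"
    unfolding ks(3) ls(3)
    by (intro foldr_mult_append subset_trans[OF ks(2) derived_set_carrier]
        subset_trans[OF ls(2) derived_set_carrier])
  then show ?thesis unfolding product_of_commutators_def
    using ks ls by (intro exI[of _ "ks @ ls"]) (auto simp del: foldr_append)
qed

lemma product_of_commutators_conj:
  assumes "product_of_commutators G n g" "h \<in> carrier G"
  shows "product_of_commutators G n (h \<otimes> g \<otimes> inv h)"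
proof -
  obtain ks where ks: "length ks = n" "set ks \<subseteq> derived_set G (carrier G)"
    "g = foldr (\<lambda>x y. x \<otimes> y) ks \<one>"
    using assms(1) unfolding product_of_commutators_def by blast
  let ?c = "\<lambda>x. h \<otimes> x \<otimes> inv h"
  have c: "inv h \<otimes> (h \<otimes> x) = x" if "x \<in> carrier G" for x
    using assms that by (simp flip: m_assoc)
  have "set ls \<subseteq> carrier G \<Longrightarrow> 
    foldr (\<lambda>x y. x \<otimes> y) (map ?c ls) \<one> = ?c (foldr (\<lambda>x y. x \<otimes> y) ls \<one>)" for ls
    using assms(2) by (induction ls) (auto simp: m_assoc c foldr_mult_closed)
  moreover have "set ks \<subseteq> carrier G" by (rule subset_trans[OF ks(2) derived_set_carrier])
  ultimately have "foldr (\<lambda>x y. x \<otimes> y) (map ?c ks) \<one> = ?c g" using ks(3) by simp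
  moreover have "set (map ?c ks) \<subseteq> derived_set G (carrier G)"
  proof -
    have "?c k \<in> derived_set G (carrier G)" if "k \<in> set ks" for k
      using conj_commutator[OF _ assms(2), of k] that ks(2) by blast
    then show ?thesis unfolding set_map by (rule image_subsetI)
  qed
  ultimately show ?thesis unfolding product_of_commutators_def
    using ks by (intro exI[of _ "map ?c ks"]) auto
qed

lemma derived_imp_product_of_commutators:
  assumes "g \<in> derived G (carrier G)"
  shows "\<exists>n. product_of_commutators G n g"
  using assms unfolding derived_def
proof (induction rule: generate.induct)
  case one
  show ?case unfolding product_of_commutators_def by (intro exI[of _ 0] exI[of _ "[]"]) simp
next
  case (incl h)
  then show ?case by (intro exI[of _ 1] product_of_commutators_one)
next
  case (inv h)
  then show ?case by (intro exI[of _ 1] product_of_commutators_one inv_commutator)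
next
  case (eng h1 h2)
  then show ?case using product_of_commutators_mult by blast
qed

lemma product_of_commutators_commutator_length:
  assumes "g \<in> derived G (carrier G)"
  shows "product_of_commutators G (commutator_length G g) g"
  unfolding commutator_length_def
  using derived_imp_product_of_commutators[OF assms] by (metis LeastI)

lemma commutator_length_le:
  "product_of_commutators G n g \<Longrightarrow> commutator_length G g \<le> n"
  unfolding commutator_length_def by (rule Least_le)

end

section \<open>Exchanges of finite order are commutators\<close>

text \<open>The partition by the \<open>p\<close>-invariant finite set \<open>breakpts\<close> has cells \<open>[lo x, hi x)\<close>, which \<open>p\<close> permutes
  by translations. Two involutions are used: \<open>flip\<close>, which interchanges the halves of each cell and
  commutes with \<open>p\<close>, and \<open>reverse\<close>, which preserves the halves and conjugates \<open>p\<close> to its inverse.\<close>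

locale finite_order_exchange =
  fixes p :: "real \<Rightarrow> real" and m :: nat
  assumes p: "exchange UNIV p" and m: "0 < m"
    and period: "x \<in> unit_interval \<Longrightarrow> (p ^^ m) x = x"
begin

lemma pow_mem: "x \<in> unit_interval \<Longrightarrow> (p ^^ i) x \<in> unit_interval"
  using exchange_mem[OF full.exchange_funpow[OF p]] .

lemma pow_inj:
  "x \<in> unit_interval \<Longrightarrow> y \<in> unit_interval \<Longrightarrow> (p ^^ i) x = (p ^^ i) y \<Longrightarrow> x = y"
  using exchange_inj[OF full.exchange_funpow[OF p]] .

lemma pow_comm: "(p ^^ i) ((p ^^ j) x) = (p ^^ j) ((p ^^ i) x)"
  by (metis add.commute comp_apply funpow_add)

lemma pow_p: "(p ^^ i) (p x) = p ((p ^^ i) x)"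
  by (simp add: funpow_swap1)

lemma pow_pred: "x \<in> unit_interval \<Longrightarrow> (p ^^ (m - 1)) (p x) = x"
  using period[of x] m by (cases m) (auto simp: funpow_swap1)

text \<open>The orbits of \<open>0\<close> and of a finite set of points that contains the discontinuities of \<open>p\<close>.\<close>

definition breakpts :: "real set" where
  "breakpts = (\<Union>i<m. (p ^^ i) ` insert 0
     ((SOME E. finite E \<and> const_off E (\<lambda>x. p x - x)) \<inter> unit_interval))"

lemma breakpts:
  shows finite_breakpts: "finite breakpts"
    and breakpts_subset: "breakpts \<subseteq> unit_interval"
    and zero_breakpts: "0 \<in> breakpts"
    and breakpts_p: "e \<in> breakpts \<Longrightarrow> p e \<in> breakpts"
    and const_off_breakpts: "const_off breakpts (\<lambda>x. p x - x)"
proof -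
  define E where "E = (SOME E. finite E \<and> const_off E (\<lambda>x. p x - x))"
  have "\<exists>E. finite E \<and> const_off E (\<lambda>x. p x - x)"
    using step_funE[OF exchangeD(2)[OF p]] by metis
  then have "finite E \<and> const_off E (\<lambda>x. p x - x)" unfolding E_def by (rule someI_ex)
  then have E: "finite E" "const_off E (\<lambda>x. p x - x)" by auto
  have b: "breakpts = (\<Union>i<m. (p ^^ i) ` insert 0 (E \<inter> unit_interval))"
    by (simp add: breakpts_def E_def)
  show "finite breakpts" unfolding b using E by blast
  show "breakpts \<subseteq> unit_interval"
  proof
    fix x assume "x \<in> breakpts"
    then obtain i e where "e \<in> insert 0 (E \<inter> unit_interval)" "x = (p ^^ i) e"
      unfolding b by blast
    then show "x \<in> unit_interval" using pow_mem[of e i] by auto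
  qed
  have sub: "insert 0 (E \<inter> unit_interval) \<subseteq> breakpts"
    unfolding b using m by (intro subset_trans[OF _ UN_upper[of 0]]) auto
  then show "0 \<in> breakpts" by blast
  show "p e \<in> breakpts" if "e \<in> breakpts"
  proof -
    obtain i d where i: "i < m" "d \<in> insert 0 (E \<inter> unit_interval)" "e = (p ^^ i) d"
      using \<open>e \<in> breakpts\<close> unfolding b by blast
    have pe: "p e = (p ^^ Suc i) d" using i by simp
    show ?thesis
    proof (cases "Suc i < m")
      case True
      then show ?thesis unfolding b pe using i(2) by blast
    next
      case False
      then have "Suc i = m" using i by simp
      then have "p e = d" using pe period[of d] i(2) by auto
      then show ?thesis using sub i(2) by blast
    qed
  qed
  show "const_off breakpts (\<lambda>x. p x - x)"
    unfolding const_off_def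
  proof (intro allI impI)
    fix x y :: real assume xy: "0 \<le> x \<and> x \<le> y \<and> y < 1 \<and> breakpts \<inter> {x<..y} = {}"
    have "E \<inter> {x<..y} \<subseteq> breakpts \<inter> {x<..y}"
      using sub xy by auto
    then have "E \<inter> {x<..y} = {}" using xy by blast
    then show "p x - x = p y - y" using const_offD[OF E(2)] xy by blast
  qed
qed

text \<open>\<open>free x y\<close> says that \<open>x \<le> y\<close> lie in the same cell of the partition by \<open>breakpts\<close>.\<close>

definition free :: "real \<Rightarrow> real \<Rightarrow> bool" where
  "free x y \<longleftrightarrow> 0 \<le> x \<and> x \<le> y \<and> y < 1 \<and> breakpts \<inter> {x<..y} = {}"

lemma free_sub: "free x y \<Longrightarrow> x \<le> z \<Longrightarrow> z \<le> y \<Longrightarrow> free x z"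
  unfolding free_def by force

lemma free_D: "free x y \<Longrightarrow> x \<in> unit_interval" "free x y \<Longrightarrow> y \<in> unit_interval" "free x y \<Longrightarrow> x \<le> y"
  unfolding free_def by auto

lemma p_free: "free x y \<Longrightarrow> p y = p x + (y - x)"
  using const_offD[OF const_off_breakpts, of x y] unfolding free_def by simp

lemma breakpts_pow: "e \<in> breakpts \<Longrightarrow> (p ^^ i) e \<in> breakpts"
  by (induction i) (auto intro: breakpts_p)

lemma free_p:
  assumes "free x y"
  shows "free (p x) (p y)"
proof -
  have "breakpts \<inter> {p x<..p y} = {}"
  proof (rule ccontr)
    assume "\<not> ?thesis"
    then obtain e where e: "e \<in> breakpts" "p x < e" "e \<le> p y" by auto
    let ?z = "x + (e - p x)"
    have z: "x < ?z" "?z \<le> y" using e p_free[OF assms] by auto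
    then have f: "free x ?z" using free_sub[OF assms, of ?z] by simp
    then have "p ?z = e" using p_free[OF f] by simp
    moreover have "(p ^^ (m - 1)) (p ?z) = ?z" by (rule pow_pred[OF free_D(2)[OF f]])
    ultimately have "?z \<in> breakpts" using breakpts_pow[OF e(1), of "m - 1"] by simp
    then show False using z assms unfolding free_def by force
  qed
  then show ?thesis
    using pow_mem[of x 1] pow_mem[of y 1] free_D[OF assms] p_free[OF assms]
    unfolding free_def by simp
qed

lemma free_pow: "free x y \<Longrightarrow> free ((p ^^ i) x) ((p ^^ i) y) \<and> (p ^^ i) y = (p ^^ i) x + (y - x)"
proof (induction i)
  case (Suc i)
  have f: "free ((p ^^ i) x) ((p ^^ i) y)" using Suc by blast
  have "free ((p ^^ Suc i) x) ((p ^^ Suc i) y)"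
    unfolding funpow.simps comp_apply by (rule free_p[OF f])
  moreover have "(p ^^ Suc i) y = (p ^^ Suc i) x + (y - x)" using p_free[OF f] Suc by simp
  ultimately show ?case by blast
qed simp

text \<open>The endpoints of the cell of \<open>x\<close>.\<close>

definition lo :: "real \<Rightarrow> real" where "lo x = Max {e \<in> breakpts. e \<le> x}"

definition hi :: "real \<Rightarrow> real" where "hi x = Min (insert 1 {e \<in> breakpts. x < e})"

lemma lo:
  assumes "x \<in> unit_interval"
  shows lo_mem: "lo x \<in> breakpts" and free_lo: "free (lo x) x"
proof -
  let ?S = "{e \<in> breakpts. e \<le> x}"
  have fin: "finite ?S" "0 \<in> ?S" using finite_breakpts zero_breakpts assms by auto
  have "lo x \<in> ?S" unfolding lo_def by (rule Max_in) (use fin in auto)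
  then have l: "lo x \<in> breakpts" "lo x \<le> x" by auto
  have "e \<le> lo x" if "e \<in> ?S" for e unfolding lo_def using fin(1) that by (rule Max_ge)
  then have "breakpts \<inter> {lo x<..x} = {}" by force
  then show "lo x \<in> breakpts" "free (lo x) x"
    using l breakpts_subset assms unfolding free_def by auto
qed

lemma lo_eqI:
  assumes "e \<in> breakpts" "free e x"
  shows "lo x = e"
proof -
  have x: "x \<in> unit_interval" by (rule free_D(2)[OF assms(2)])
  have "\<not> lo x < e"
  proof
    assume "lo x < e"
    then have "e \<in> breakpts \<inter> {lo x<..x}" using assms free_D(3)[OF assms(2)] by simp
    then show False using free_lo[OF x] unfolding free_def by blast
  qed
  moreover have "\<not> e < lo x"
  proof
    assume "e < lo x"
    then have "lo x \<in> breakpts \<inter> {e<..x}" using lo_mem[OF x] free_D(3)[OF free_lo[OF x]] by simp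
    then show False using assms(2) unfolding free_def by blast
  qed
  ultimately show ?thesis by simp
qed

lemma hi:
  assumes "x \<in> unit_interval"
  shows hi_mem: "hi x \<in> insert 1 breakpts" and hi_gt: "x < hi x" and hi_le: "hi x \<le> 1"
    and free_hi: "x \<le> y \<Longrightarrow> y < hi x \<Longrightarrow> free x y"
proof -
  let ?S = "insert 1 {e \<in> breakpts. x < e}"
  have fin: "finite ?S" using finite_breakpts by simp
  have h: "hi x \<in> ?S" unfolding hi_def by (rule Min_in) (use fin in auto)
  then show "hi x \<in> insert 1 breakpts" "x < hi x" using assms by auto
  have le: "hi x \<le> e" if "e \<in> ?S" for e unfolding hi_def using fin that by (rule Min_le)
  then show "hi x \<le> 1" by blast
  show "free x y" if "x \<le> y" "y < hi x"
    using that le assms unfolding free_def by fastforce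
qed

lemma hi_free:
  assumes "free x y"
  shows "hi y = hi x"
proof -
  have "e \<in> breakpts \<Longrightarrow> (y < e) = (x < e)" for e
    using assms unfolding free_def by force
  then have "{e \<in> breakpts. y < e} = {e \<in> breakpts. x < e}" by blast
  then show ?thesis unfolding hi_def by simp
qed

lemma lo_free:
  assumes "free x y"
  shows "lo y = lo x"
proof (rule lo_eqI)
  have x: "x \<in> unit_interval" by (rule free_D(1)[OF assms])
  show "lo x \<in> breakpts" by (rule lo_mem[OF x])
  have "{lo x<..y} \<subseteq> {lo x<..x} \<union> {x<..y}" by auto
  then show "free (lo x) y" using free_lo[OF x] assms unfolding free_def by auto
qed

lemma lo_p: "x \<in> unit_interval \<Longrightarrow> lo (p x) = p (lo x)"
  by (rule lo_eqI[OF breakpts_p[OF lo_mem] free_p[OF free_lo]])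

text \<open>The distance to the right end of the cell cannot decrease along an orbit; as orbits are
  periodic, it is constant.\<close>

lemma gap_p_ge:
  assumes x: "x \<in> unit_interval"
  shows "hi x - x \<le> hi (p x) - p x"
proof (rule ccontr)
  assume a: "\<not> ?thesis"
  have px: "p x \<in> unit_interval" using pow_mem[OF x, of 1] by simp
  let ?y = "x + (hi (p x) - p x)"
  have y: "x \<le> ?y" "?y < hi x" using a hi_gt[OF px] by auto
  have f: "free x ?y" by (rule free_hi[OF x y])
  have py: "p ?y = hi (p x)" using p_free[OF f] by simp
  have "free (p x) (hi (p x))" using free_p[OF f] py by simp
  then have "hi (p x) < 1" "hi (p x) \<notin> breakpts" using hi_gt[OF px] unfolding free_def by auto
  then show False using hi_mem[OF px] by auto
qed

lemma gap_pow_ge: "x \<in> unit_interval \<Longrightarrow> hi x - x \<le> hi ((p ^^ i) x) - (p ^^ i) x"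
proof (induction i)
  case (Suc i)
  then show ?case using gap_p_ge[OF pow_mem[of x i]] by simp
qed simp

lemma gap_p:
  assumes x: "x \<in> unit_interval"
  shows "hi (p x) - p x = hi x - x"
proof -
  have px: "p x \<in> unit_interval" using pow_mem[OF x, of 1] by simp
  show ?thesis using gap_p_ge[OF x] gap_pow_ge[OF px, of "m - 1"] pow_pred[OF x] by simp
qed

text \<open>Half the length of the cell of \<open>x\<close>, the left half of the cell, and the exchange of its two halves.\<close>

definition half :: "real \<Rightarrow> real" where "half x = (hi x - lo x) / 2"

definition left :: "real \<Rightarrow> bool" where "left x \<longleftrightarrow> x < lo x + half x"

definition flip :: "real \<Rightarrow> real" where "flip x = (if left x then x + half x else x - half x)"

lemma p_lo: "x \<in> unit_interval \<Longrightarrow> p x - p (lo x) = x - lo x"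
  using p_free[OF free_lo] by simp

lemma half_p: "x \<in> unit_interval \<Longrightarrow> half (p x) = half x"
  unfolding half_def using gap_p[of x] lo_p[of x] p_lo[of x] by simp

lemma left_p: "x \<in> unit_interval \<Longrightarrow> left (p x) = left x"
  unfolding left_def using half_p[of x] lo_p[of x] p_lo[of x] by auto

lemma left_pow: "x \<in> unit_interval \<Longrightarrow> left ((p ^^ i) x) = left x"
  by (induction i) (auto simp: left_p pow_mem simp del: atLeastLessThan_iff)

lemma flip_bounds:
  assumes x: "x \<in> unit_interval"
  shows "lo x \<le> flip x" "flip x < hi x"
  using free_D(3)[OF free_lo[OF x]] hi_gt[OF x]
  by (auto simp: flip_def left_def half_def field_simps)

lemma same_cell:
  assumes x: "x \<in> unit_interval" and y: "lo x \<le> y" "y < hi x"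
  shows "y \<in> unit_interval" "lo y = lo x" "hi y = hi x" "(p ^^ i) y = (p ^^ i) x + (y - x)"
proof -
  have l: "lo x \<in> unit_interval" using lo_mem[OF x] breakpts_subset by blast
  have h: "hi (lo x) = hi x" using hi_free[OF free_lo[OF x]] by simp
  have f: "free (lo x) y" by (rule free_hi[OF l y(1)]) (simp add: y h)
  show "y \<in> unit_interval" by (rule free_D(2)[OF f])
  show "lo y = lo x" by (rule lo_eqI[OF lo_mem[OF x] f])
  show "hi y = hi x" using hi_free[OF f] h by simp
  show "(p ^^ i) y = (p ^^ i) x + (y - x)"
    using free_pow[OF f, of i] free_pow[OF free_lo[OF x], of i] by simp
qed

lemma flip:
  assumes x: "x \<in> unit_interval"
  shows flip_mem: "flip x \<in> unit_interval" and lo_flip: "lo (flip x) = lo x"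
    and half_flip: "half (flip x) = half x" and left_flip: "left (flip x) \<longleftrightarrow> \<not> left x"
    and flip_flip: "flip (flip x) = x"
proof -
  note c = same_cell[OF x flip_bounds[OF x]]
  show "flip x \<in> unit_interval" "lo (flip x) = lo x" by (rule c)+
  show h: "half (flip x) = half x" unfolding half_def using c by simp
  have hi: "hi x = lo x + half x + half x" unfolding half_def by simp
  have b: "lo x \<le> x" "x < hi x" using free_D(3)[OF free_lo[OF x]] hi_gt[OF x] by auto
  show l: "left (flip x) \<longleftrightarrow> \<not> left x"
    unfolding left_def[of "flip x"] c(2) h unfolding flip_def using b hi
    by (auto simp: left_def)
  show "flip (flip x) = x"
    unfolding flip_def[of "flip x"] l h unfolding flip_def by simp
qed

lemma flip_p:
  assumes x: "x \<in> unit_interval"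
  shows "flip (p x) = p (flip x)"
  using same_cell(4)[OF x flip_bounds[OF x], of 1] half_p[OF x] left_p[OF x]
  by (simp add: flip_def)

lemma flip_pow: "x \<in> unit_interval \<Longrightarrow> flip ((p ^^ i) x) = (p ^^ i) (flip x)"
  by (induction i) (auto simp: flip_p pow_mem simp del: atLeastLessThan_iff)

text \<open>Each orbit gets a base point, chosen in terms of the orbit as a set, hence the same for all points of
  the orbit; \<open>orbit_index e\<close> is a number of steps that leads from \<open>e\<close> to it. It will be used for
  left endpoints of cells only, so that it is constant on cells.\<close>

definition orbit_index :: "real \<Rightarrow> nat" where
  "orbit_index e = (SOME k. (p ^^ k) e = (SOME z. z \<in> range (\<lambda>i. (p ^^ i) e)))"

lemma orbit_index: "(p ^^ orbit_index e) e = (SOME z. z \<in> range (\<lambda>i. (p ^^ i) e))"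
proof -
  have "(SOME z. z \<in> range (\<lambda>i. (p ^^ i) e)) \<in> range (\<lambda>i. (p ^^ i) e)"
    by (rule someI[of _ "(p ^^ 0) e"]) blast
  then have "\<exists>k. (p ^^ k) e = (SOME z. z \<in> range (\<lambda>i. (p ^^ i) e))" by force
  then show ?thesis unfolding orbit_index_def by (rule someI_ex)
qed

lemma orbit_index_p:
  assumes e: "e \<in> unit_interval"
  shows "(p ^^ orbit_index (p e)) (p e) = (p ^^ orbit_index e) e"
proof -
  have "(p ^^ i) e \<in> range (\<lambda>i. (p ^^ i) (p e))" for i
  proof -
    have "(p ^^ i) e = (p ^^ (i + (m - 1))) (p e)"
      using pow_pred[OF e] by (simp add: funpow_add)
    then show ?thesis by blast
  qed
  moreover have "(p ^^ i) (p e) \<in> range (\<lambda>i. (p ^^ i) e)" for i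
    by (rule range_eqI[of _ _ "Suc i"]) (simp add: funpow_swap1)
  ultimately have "range (\<lambda>i. (p ^^ i) (p e)) = range (\<lambda>i. (p ^^ i) e)" by blast
  then show ?thesis unfolding orbit_index by simp
qed

text \<open>The point in the cell of the base point that corresponds to \<open>x\<close>.\<close>

definition base :: "real \<Rightarrow> real" where "base x = (p ^^ orbit_index (lo x)) x"

text \<open>With \<open>b = base x\<close> and \<open>x = p\<^sup>-\<^sup>k b\<close>, \<open>reverse x\<close> is \<open>p\<^sup>k b\<close>. The number \<open>k\<close> matters only modulo
  the period of \<open>x\<close>.\<close>

definition reverse :: "real \<Rightarrow> real" where "reverse x = (p ^^ orbit_index (lo x)) (base x)"

lemma base_p:
  assumes x: "x \<in> unit_interval"
  shows "base (p x) = base x"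
proof -
  let ?j = "orbit_index (p (lo x))" and ?k = "orbit_index (lo x)"
  have l: "lo x \<in> unit_interval" using lo_mem[OF x] breakpts_subset by blast
  note t = free_pow[OF free_lo[OF x], THEN conjunct2]
  have "(p ^^ ?j) (p x) = (p ^^ ?j) (p (lo x)) + (x - lo x)"
    using t[of "Suc ?j"] by (simp add: funpow_swap1)
  also have "\<dots> = (p ^^ ?k) x" using orbit_index_p[OF l] t[of ?k] by simp
  finally show ?thesis unfolding base_def lo_p[OF x] .
qed

lemma base_pow: "x \<in> unit_interval \<Longrightarrow> base ((p ^^ i) x) = base x"
  by (induction i) (auto simp: base_p pow_mem simp del: atLeastLessThan_iff)

lemma reverse_p:
  assumes x: "x \<in> unit_interval"
  shows "p (reverse (p x)) = reverse x"
proof -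
  let ?j = "orbit_index (lo (p x))" and ?k = "orbit_index (lo x)"
  have "p (reverse (p x)) = p ((p ^^ ?j) ((p ^^ ?k) x))"
    unfolding reverse_def base_p[OF x] by (simp add: base_def)
  also have "\<dots> = (p ^^ ?k) ((p ^^ ?j) (p x))" by (simp add: pow_p pow_comm)
  also have "\<dots> = (p ^^ ?k) (base (p x))" by (simp add: base_def)
  finally show ?thesis unfolding base_p[OF x] reverse_def .
qed

lemma reverse_pow: "reverse x = (p ^^ (orbit_index (lo x) + orbit_index (lo x))) x"
  unfolding reverse_def base_def by (simp add: funpow_add)

lemma reverse_mem: "x \<in> unit_interval \<Longrightarrow> reverse x \<in> unit_interval"
  unfolding reverse_pow by (rule pow_mem)

lemma reverse_reverse:
  assumes x: "x \<in> unit_interval"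
  shows "reverse (reverse x) = x"
proof -
  let ?k = "orbit_index (lo x)" and ?j = "orbit_index (lo (reverse x))"
  have b: "base (reverse x) = (p ^^ ?k) x"
    unfolding reverse_pow[of x] base_pow[OF x] by (simp add: base_def)
  have "(p ^^ ?k) ((p ^^ ?j) ((p ^^ ?k) x)) = (p ^^ ?j) (reverse x)"
    unfolding reverse_def[of x] base_def[of x] by (simp add: pow_comm)
  also have "\<dots> = (p ^^ ?k) x" using b by (simp add: base_def)
  finally have "(p ^^ ?j) ((p ^^ ?k) x) = x"
    by (rule pow_inj[OF pow_mem[OF pow_mem[OF x]] x])
  then show ?thesis unfolding reverse_def[of "reverse x"] b .
qed

lemma reverse_flip: "x \<in> unit_interval \<Longrightarrow> reverse (flip x) = flip (reverse x)"
  unfolding reverse_pow by (simp add: lo_flip flip_pow del: atLeastLessThan_iff)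

lemma left_reverse: "x \<in> unit_interval \<Longrightarrow> left (reverse x) = left x"
  unfolding reverse_pow by (rule left_pow)

lemma midpoints:
  assumes "0 \<le> x" "x \<le> y" "y < 1" "(breakpts \<union> (\<lambda>e. e + half e) ` breakpts) \<inter> {x<..y} = {}"
  shows "free x y" "left x = left y"
proof -
  show f: "free x y" using assms unfolding free_def by blast
  have x: "x \<in> unit_interval" using assms by simp
  have l: "lo x \<in> unit_interval" using lo_mem[OF x] breakpts_subset by blast
  have h: "half y = half x" "lo y = lo x" "half (lo x) = half x"
    using lo_free[OF f] hi_free[OF f] lo_free[OF free_lo[OF x]] hi_free[OF free_lo[OF x]]
    unfolding half_def by simp_all
  have "lo x + half (lo x) \<notin> {x<..y}" using assms(4) lo_mem[OF x] by blast
  then show "left x = left y" unfolding left_def h using assms(2) by (auto simp: h)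
qed

lemma step_fun_left: "step_fun UNIV left"
  by (rule step_funI[of "breakpts \<union> (\<lambda>e. e + half e) ` breakpts"])
    (use finite_breakpts midpoints in auto)

lemma exchange_reverse_flip: "exchange UNIV (\<lambda>x. reverse (flip x))"
  unfolding exchange_def
proof (intro conjI)
  show "bij_betw (\<lambda>x. reverse (flip x)) unit_interval unit_interval"
    by (rule bij_betwI[where g = "\<lambda>x. reverse (flip x)"])
      (simp_all add: reverse_mem flip_mem reverse_flip flip_flip reverse_reverse
         del: atLeastLessThan_iff)
  show "step_fun UNIV (\<lambda>x. reverse (flip x) - x)"
  proof (rule step_funI[of "breakpts \<union> (\<lambda>e. e + half e) ` breakpts"])
    fix x y :: real
    assume xy: "0 \<le> x" "x \<le> y" "y < 1"
      "(breakpts \<union> (\<lambda>e. e + half e) ` breakpts) \<inter> {x<..y} = {}"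
    note f = midpoints[OF xy]
    have x: "x \<in> unit_interval" and y: "y \<in> unit_interval" using xy by auto
    have h: "half y = half x" "lo y = lo x" "hi y = hi x"
      using lo_free[OF f(1)] hi_free[OF f(1)] unfolding half_def by simp_all
    have s: "flip y - flip x = y - x" unfolding flip_def using f(2) h by simp
    have "lo (flip x) \<le> flip y" "flip y < hi (flip x)"
      using flip_bounds[OF y] same_cell(2,3)[OF x flip_bounds[OF x]] h by auto
    from same_cell(4)[OF flip_mem[OF x] this]
    have "reverse (flip y) = reverse (flip x) + (flip y - flip x)"
      unfolding reverse_pow using lo_flip[OF x] lo_flip[OF y] h by simp
    then show "reverse (flip x) - x = reverse (flip y) - y" using s by simp
  qed (use finite_breakpts in auto)
qed auto

text \<open>The map \<open>p\<close> on the left halves of the cells, and the identity on the right halves.\<close>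

definition left_part :: "real \<Rightarrow> real" where "left_part x = (if left x then p x else x)"

lemma exchange_left_part: "exchange UNIV left_part"
  unfolding exchange_def
proof (intro conjI)
  have p1: "p x \<in> unit_interval" if "x \<in> unit_interval" for x
    using exchange_mem[OF p that] .
  have q: "p ((p ^^ (m - 1)) x) = x" if "x \<in> unit_interval" for x
    using pow_pred[OF that] by (simp add: pow_p)
  show "bij_betw left_part unit_interval unit_interval"
    by (rule bij_betwI[where g = "\<lambda>x. if left x then (p ^^ (m - 1)) x else x"])
      (simp_all add: left_part_def p1 q[unfolded One_nat_def] pow_mem left_p left_pow
         pow_pred[unfolded One_nat_def] del: atLeastLessThan_iff)
  have "step_fun UNIV (\<lambda>x. if left x then p x - x else 0)"
    by (rule step_fun_apply2[OF step_fun_left exchangeD(2)[OF p], where F = "\<lambda>l d. if l then d else 0"])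
  moreover have "(\<lambda>x. left_part x - x) = (\<lambda>x. if left x then p x - x else 0)"
    by (auto simp: left_part_def fun_eq_iff)
  ultimately show "step_fun UNIV (\<lambda>x. left_part x - x)" by simp
qed auto

text \<open>With \<open>w = reverse \<circ> flip\<close>, the conjugate by \<open>w\<close> of the inverse of \<open>left_part\<close> is \<open>p\<close> on the right
  halves, so that the commutator of \<open>left_part\<close> and \<open>w\<close> is \<open>p\<close>.\<close>

theorem finite_order_is_commutator: "iet_of p \<in> derived_set G (carrier G)"
proof (rule G.commutatorI)
  let ?w = "\<lambda>x. reverse (flip x)"
  show "iet_of left_part \<in> carrier G" "iet_of ?w \<in> carrier G" "iet_of p \<in> carrier G"
    using iet_restrict exchange_left_part exchange_reverse_flip p by auto
  have "left_part (?w x) = p (?w (left_part x))" if x: "x \<in> unit_interval" for x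
  proof (cases "left x")
    case True
    have "p (?w (p x)) = ?w x"
      using reverse_p[OF flip_mem[OF x]] flip_p[OF x] by simp
    then show ?thesis
      using True left_reverse[OF flip_mem[OF x]] left_flip[OF x] by (simp add: left_part_def)
  next
    case False
    then show ?thesis
      using left_reverse[OF flip_mem[OF x]] left_flip[OF x] by (simp add: left_part_def)
  qed
  then have "iet_of (\<lambda>x. left_part (?w x)) = iet_of (\<lambda>x. p (?w (left_part x)))"
    by (rule restrict_ext)
  then show "iet_of left_part \<otimes>\<^bsub>G\<^esub> iet_of ?w = iet_of p \<otimes>\<^bsub>G\<^esub> iet_of ?w \<otimes>\<^bsub>G\<^esub> iet_of left_part"
    by (simp only: mult_iet_of exchange_left_part exchange_reverse_flip p
        full.exchange_compose[OF p exchange_reverse_flip])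
qed

end

section \<open>Splitting off an exchange of finite order\<close>

text \<open>The points that have no period between \<open>1\<close> and \<open>N\<close> under \<open>g\<close>.\<close>

definition moved :: "nat \<Rightarrow> (real \<Rightarrow> real) \<Rightarrow> real \<Rightarrow> bool" where
  "moved N g x \<longleftrightarrow> (\<forall>i\<in>{1..N}. (g ^^ i) x \<noteq> x)"

text \<open>The first return to \<open>J\<close>. The search for the return time stops at \<open>L\<close>; the value is meaningful only
  when a return occurs within \<open>L\<close> steps.\<close>

definition return_time :: "nat \<Rightarrow> (real \<Rightarrow> real) \<Rightarrow> real set \<Rightarrow> real \<Rightarrow> nat" where
  "return_time L g J x = (LEAST i. i \<in> {1..L} \<and> (g ^^ i) x \<in> J)"

text \<open>The first return map to \<open>J\<close>, extended by the identity outside \<open>J\<close>.\<close>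

definition first_return :: "nat \<Rightarrow> (real \<Rightarrow> real) \<Rightarrow> real set \<Rightarrow> real \<Rightarrow> real" where
  "first_return L g J x = (if x \<in> J then (g ^^ return_time L g J x) x else x)"

lemma return_time:
  assumes "\<exists>i\<in>{1..L}. (g ^^ i) x \<in> J"
  shows return_time_bounds: "return_time L g J x \<in> {1..L}"
    and return_time_in: "(g ^^ return_time L g J x) x \<in> J"
    and return_time_before: "1 \<le> j \<Longrightarrow> j < return_time L g J x \<Longrightarrow> (g ^^ j) x \<notin> J"
proof -
  have "\<exists>i. i \<in> {1..L} \<and> (g ^^ i) x \<in> J" using assms by blast
  from LeastI_ex[OF this] have
    t: "return_time L g J x \<in> {1..L}" "(g ^^ return_time L g J x) x \<in> J"
    unfolding return_time_def by auto
  then show "return_time L g J x \<in> {1..L}" "(g ^^ return_time L g J x) x \<in> J" by auto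
  show "(g ^^ j) x \<notin> J" if "1 \<le> j" "j < return_time L g J x"
    using not_less_Least[of j "\<lambda>i. i \<in> {1..L} \<and> (g ^^ i) x \<in> J"] that t
    unfolding return_time_def by auto
qed

lemma return_time_eqI:
  assumes "t \<in> {1..L}" "(g ^^ t) x \<in> J" "\<And>j. 1 \<le> j \<Longrightarrow> j < t \<Longrightarrow> (g ^^ j) x \<notin> J"
  shows "return_time L g J x = t"
  unfolding return_time_def by (rule Least_equality) (use assms in \<open>auto simp: not_less[symmetric]\<close>)

text \<open>An exchange \<open>g\<close> together with its inverse \<open>h\<close>; the situation is symmetric in both.\<close>

locale exchange_pair = unit_subgroup D for D +
  fixes g h :: "real \<Rightarrow> real"
  assumes g: "exchange D g"
    and h: "exchange D h"
    and gh: "x \<in> unit_interval \<Longrightarrow> g (h x) = x"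
    and hg: "x \<in> unit_interval \<Longrightarrow> h (g x) = x"
begin

lemma mem:
  assumes "x \<in> unit_interval"
  shows "(g ^^ i) x \<in> unit_interval" "(h ^^ i) x \<in> unit_interval"
  using exchange_mem[OF exchange_funpow[OF g] assms] exchange_mem[OF exchange_funpow[OF h] assms]
  by auto

lemma pow_cancel: "x \<in> unit_interval \<Longrightarrow> i \<le> j \<Longrightarrow> (h ^^ i) ((g ^^ j) x) = (g ^^ (j - i)) x"
proof (induction i)
  case (Suc i)
  then obtain k where k: "j - i = Suc k" "j - Suc i = k" by (metis Suc_diff_Suc Suc_le_lessD)
  have "(h ^^ Suc i) ((g ^^ j) x) = h ((g ^^ (j - i)) x)" using Suc by simp
  also have "\<dots> = (g ^^ k) x" using k hg[OF mem(1)[OF Suc.prems(1)]] by simp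
  finally show ?case using k by simp
qed simp

lemma pair_swap: "exchange_pair D h g"
  by unfold_locales (fact g h gh hg)+

end

text \<open>The first return map of the inverse undoes the first return map.\<close>

lemma (in exchange_pair) first_return_inverse:
  assumes J: "J \<subseteq> unit_interval" and x: "x \<in> unit_interval"
    and ret: "\<And>x. x \<in> J \<Longrightarrow> \<exists>i\<in>{1..L}. (g ^^ i) x \<in> J"
  shows "first_return L h J (first_return L g J x) = x"
proof (cases "x \<in> J")
  case True
  define t where "t = return_time L g J x"
  note t = return_time[OF ret[OF True], folded t_def]
  have inverse_pow: "(h ^^ i) ((g ^^ t) x) = (g ^^ (t - i)) x" if "i \<le> t" for i
    using pow_cancel[OF x that] .
  have "return_time L h J ((g ^^ t) x) = t"
  proof (rule return_time_eqI)
    show "t \<in> {1..L}" by (rule t)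
    show "(h ^^ t) ((g ^^ t) x) \<in> J" using inverse_pow[of t] True by simp
    show "(h ^^ j) ((g ^^ t) x) \<notin> J" if "1 \<le> j" "j < t" for j
      using inverse_pow[of j] t(3)[of "t - j"] that by simp
  qed
  then show ?thesis using True t(2) inverse_pow[of t] unfolding first_return_def by (simp flip: t_def)
qed (simp add: first_return_def)

context exchange_pair
begin

lemma first_return_mem:
  "J \<subseteq> unit_interval \<Longrightarrow> x \<in> unit_interval \<Longrightarrow> first_return L g J x \<in> unit_interval"
  unfolding first_return_def using mem(1) by simp

lemma exchange_first_return:
  assumes J: "J \<subseteq> unit_interval" "step_fun D (\<lambda>x. x \<in> J)"
    and ret: "\<And>x. x \<in> J \<Longrightarrow> \<exists>i\<in>{1..L}. (g ^^ i) x \<in> J"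
      "\<And>x. x \<in> J \<Longrightarrow> \<exists>i\<in>{1..L}. (h ^^ i) x \<in> J"
  shows "exchange D (first_return L g J)"
  unfolding exchange_def
proof (intro conjI ballI)
  interpret S: exchange_pair D h g by (rule pair_swap)
  show "bij_betw (first_return L g J) unit_interval unit_interval"
    by (rule bij_betwI[where g = "first_return L h J"])
      (simp_all add: first_return_mem[OF J(1)] S.first_return_mem[OF J(1)]
         first_return_inverse[OF J(1) _ ret(1)] S.first_return_inverse[OF J(1) _ ret(2)]
         del: atLeastLessThan_iff)
  have disp: "step_fun D (\<lambda>x. ((g ^^ i) x \<in> J, (g ^^ i) x - x))" for i
    by (rule step_fun_apply2[OF step_fun_compose[OF exchange_funpow[OF g] J(2)]
        exchangeD(2)[OF exchange_funpow[OF g]], where F = Pair])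
  show "step_fun D (\<lambda>x. first_return L g J x - x)"
  proof (rule step_fun_determined[of "{0..L}" D "\<lambda>i x. ((g ^^ i) x \<in> J, (g ^^ i) x - x)"])
    fix x y assume "x \<in> unit_interval" "y \<in> unit_interval"
      and eq: "\<And>i. i \<in> {0..L} \<Longrightarrow>
        ((g ^^ i) x \<in> J, (g ^^ i) x - x) = ((g ^^ i) y \<in> J, (g ^^ i) y - y)"
    have xy: "x \<in> J \<longleftrightarrow> y \<in> J" using eq[of 0] by simp
    have "(i \<in> {1..L} \<and> (g ^^ i) x \<in> J) = (i \<in> {1..L} \<and> (g ^^ i) y \<in> J)" for i
      using eq[of i] by auto
    then have t: "return_time L g J x = return_time L g J y" unfolding return_time_def by simp
    show "first_return L g J x - x = first_return L g J y - y"
    proof (cases "x \<in> J")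
      case True
      have "return_time L g J x \<in> {0..L}" using return_time_bounds[OF ret(1)[OF True]] by simp
      then show ?thesis using eq[of "return_time L g J x"] True xy t
        unfolding first_return_def by simp
    qed (use xy in \<open>simp add: first_return_def\<close>)
  qed (use disp in auto)
  fix x assume x: "x \<in> unit_interval"
  show "first_return L g J x - x \<in> D"
    using exchangeD(3)[OF exchange_funpow[OF g] x] zero_mem unfolding first_return_def by simp
qed

lemma funpow_until_return:
  assumes "\<And>j. 1 \<le> j \<Longrightarrow> j < i \<Longrightarrow> (g ^^ j) x \<notin> J" "1 \<le> i"
  shows "((\<lambda>x. first_return L h J (g x)) ^^ i) x = first_return L h J ((g ^^ i) x)"
proof -
  have "((\<lambda>x. first_return L h J (g x)) ^^ j) x = (g ^^ j) x" if "j < i" for j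
    using that
  proof (induction j)
    case (Suc j)
    then show ?case using assms(1)[of "Suc j"] by (simp add: first_return_def)
  qed simp
  from this[of "i - 1"] show ?thesis using assms(2) by (cases i) auto
qed

text \<open>Following \<open>g\<close> until the first visit to \<open>J\<close> and then applying the inverse of the first
  return map \<open>first_return L g J\<close>, closes the orbit segments of \<open>g\<close> up to cycles.\<close>

lemma first_return_periodic:
  assumes J: "J \<subseteq> unit_interval" "step_fun D (\<lambda>x. x \<in> J)" and x: "x \<in> unit_interval"
    and ret: "\<And>x. x \<in> J \<Longrightarrow> \<exists>i\<in>{1..L}. (g ^^ i) x \<in> J"
      "\<And>x. x \<in> J \<Longrightarrow> \<exists>i\<in>{1..L}. (h ^^ i) x \<in> J"
    and cases: "(\<exists>i\<in>{1..L}. (g ^^ i) x \<in> J) \<or> (\<exists>i\<in>{1..L}. (g ^^ i) x = x)"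
  shows "\<exists>i\<in>{1..L}. ((\<lambda>x. first_return L h J (g x)) ^^ i) x = x"
proof -
  interpret S: exchange_pair D h g by (rule pair_swap)
  let ?p = "\<lambda>x. first_return L h J (g x)"
  show ?thesis
  proof (cases "\<exists>i\<in>{1..L}. (g ^^ i) x \<in> J")
    case True
    define i where "i = return_time L g J x"
    note i = return_time[OF True, folded i_def]
    define z where "z = (?p ^^ i) x"
    have z: "z = first_return L h J ((g ^^ i) x)"
      unfolding z_def by (rule funpow_until_return) (use i in auto)
    have zJ: "z \<in> J" unfolding z first_return_def using return_time_in[OF ret(2)[OF i(2)]] i(2) by simp
    then have zI: "z \<in> unit_interval" using J by blast
    define t where "t = return_time L g J z"
    note t = return_time[OF ret(1)[OF zJ], folded t_def]
    have "(?p ^^ t) z = first_return L h J ((g ^^ t) z)"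
      by (rule funpow_until_return) (use t in auto)
    also have "(g ^^ t) z = first_return L g J z" using zJ unfolding first_return_def t_def by simp
    finally have "(?p ^^ t) z = z" using first_return_inverse[OF J(1) zI ret(1)] by simp
    then have "(?p ^^ i) ((?p ^^ t) x) = (?p ^^ i) x"
      unfolding z_def by (metis add.commute comp_apply funpow_add)
    moreover have p: "exchange D ?p"
      by (rule exchange_compose[OF S.exchange_first_return[OF J ret(2) ret(1)] g])
    ultimately have "(?p ^^ t) x = x"
      using exchange_inj[OF exchange_funpow[OF p], of "(?p ^^ t) x" x i]
        exchange_mem[OF exchange_funpow[OF p] x] x by simp
    then show ?thesis using t(1) by blast
  next
    case False
    then obtain i where i: "i \<in> {1..L}" "(g ^^ i) x = x" using cases by blast
    have "(?p ^^ i) x = first_return L h J ((g ^^ i) x)"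
      by (rule funpow_until_return) (use False i in auto)
    moreover have "x \<notin> J" using False i by metis
    ultimately have "(?p ^^ i) x = x" using i by (simp add: first_return_def)
    then show ?thesis using i by blast
  qed
qed

lemma moved_g: "x \<in> unit_interval \<Longrightarrow> moved N g (g x) \<longleftrightarrow> moved N g x"
proof -
  assume x: "x \<in> unit_interval"
  have "(g ^^ i) (g x) = g x \<longleftrightarrow> (g ^^ i) x = x" for i
    using exchange_inj[OF g mem(1)[OF x] x, of i] by (auto simp: funpow_swap1[symmetric])
  then show ?thesis unfolding moved_def by simp
qed

lemma moved_h: "x \<in> unit_interval \<Longrightarrow> moved N g (h x) \<longleftrightarrow> moved N g x"
  using moved_g[of "h x" N] gh[of x] exchange_mem[OF h, of x] by simp

lemma moved_pow:
  assumes x: "x \<in> unit_interval"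
  shows "moved N g ((g ^^ i) x) \<longleftrightarrow> moved N g x" "moved N g ((h ^^ i) x) \<longleftrightarrow> moved N g x"
proof (induction i)
  case (Suc i)
  {
    case 1
    show ?case using Suc moved_g[OF mem(1)[OF x]] by simp
  next
    case 2
    show ?case using Suc moved_h[OF mem(2)[OF x]] by simp
  }
qed auto

text \<open>An exchange has only finitely many displacements, so the non-zero ones are bounded away from \<open>0\<close>.\<close>

lemma displacement_gap:
  obtains \<delta> where "\<delta> > 0"
    "\<And>x i. x \<in> unit_interval \<Longrightarrow> i \<in> {1..N} \<Longrightarrow> (g ^^ i) x \<noteq> x \<Longrightarrow> \<delta> \<le> \<bar>(g ^^ i) x - x\<bar>"
proof -
  let ?V = "insert 1 ((\<Union>i\<in>{1..N}. (\<lambda>x. \<bar>(g ^^ i) x - x\<bar>) ` unit_interval) - {0})"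
  have "finite ((\<lambda>x. \<bar>(g ^^ i) x - x\<bar>) ` unit_interval)" for i
    by (rule step_fun_finite_range[OF step_fun_apply[OF exchangeD(2)[OF exchange_funpow[OF g]],
        where F = abs]])
  then have fin: "finite ?V" by blast
  have "Min ?V \<in> ?V" by (rule Min_in) (use fin in auto)
  then have "0 < Min ?V" by auto
  moreover have "Min ?V \<le> \<bar>(g ^^ i) x - x\<bar>"
    if "x \<in> unit_interval" "i \<in> {1..N}" "(g ^^ i) x \<noteq> x" for x i
  proof (rule Min_le[OF fin])
    have "\<bar>(g ^^ i) x - x\<bar> \<in> (\<Union>i\<in>{1..N}. (\<lambda>x. \<bar>(g ^^ i) x - x\<bar>) ` unit_interval)"
      using that(1,2) by blast
    then show "\<bar>(g ^^ i) x - x\<bar> \<in> ?V" using that(3) by simp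
  qed
  ultimately show ?thesis using that by blast
qed

lemma step_fun_moved: "step_fun D (moved N g)"
  unfolding moved_def
proof (rule step_fun_Ball)
  show "step_fun D (\<lambda>x. (g ^^ i) x \<noteq> x)" for i
    using step_fun_apply[OF exchangeD(2)[OF exchange_funpow[OF g]], where F = "\<lambda>d. d \<noteq> 0"] by simp
qed simp

text \<open>The set is built greedily from intervals \<open>[n d, (n + 1) d)\<close> that are shorter than every relevant
  displacement: the part of the interval whose orbit segments avoid what has been selected so far is
  added. Points of small period are left out; any other point that has not been added is close, along
  its orbit, to a selected one.\<close>

lemma disjoint_images_set:
  assumes dense: "\<And>\<epsilon>. 0 < \<epsilon> \<Longrightarrow> \<exists>d\<in>D. 0 < d \<and> d < \<epsilon>"
  obtains J where "step_fun D (\<lambda>x. x \<in> J)" "J \<subseteq> {x \<in> unit_interval. moved N g x}"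
    "\<forall>x\<in>J. \<forall>i\<in>{1..N}. (g ^^ i) x \<notin> J"
    "\<forall>x\<in>unit_interval. moved N g x \<longrightarrow> (\<exists>i\<le>N. (g ^^ i) x \<in> J \<or> (h ^^ i) x \<in> J)"
proof -
  obtain \<delta> where \<delta>: "\<delta> > 0"
    "\<And>x i. x \<in> unit_interval \<Longrightarrow> i \<in> {1..N} \<Longrightarrow> (g ^^ i) x \<noteq> x \<Longrightarrow> \<delta> \<le> \<bar>(g ^^ i) x - x\<bar>"
    using displacement_gap[of N] by metis
  obtain d where d: "d \<in> D" "0 < d" "d < \<delta>" using dense[OF \<delta>(1)] by blast
  define good where "good n J \<longleftrightarrow>
    step_fun D (\<lambda>x. x \<in> J) \<and> J \<subseteq> {x \<in> unit_interval. moved N g x} \<and>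
    (\<forall>x\<in>J. \<forall>i\<in>{1..N}. (g ^^ i) x \<notin> J) \<and>
    (\<forall>x\<in>unit_interval. moved N g x \<and> x < real n * d \<longrightarrow>
       (\<exists>i\<le>N. (g ^^ i) x \<in> J \<or> (h ^^ i) x \<in> J))" for n J
  have goodD: "step_fun D (\<lambda>x. x \<in> J)" "J \<subseteq> {x \<in> unit_interval. moved N g x}"
    "\<And>x i. x \<in> J \<Longrightarrow> i \<in> {1..N} \<Longrightarrow> (g ^^ i) x \<notin> J"
    "\<And>x. x \<in> unit_interval \<Longrightarrow> moved N g x \<Longrightarrow> x < real n * d \<Longrightarrow>
      \<exists>i\<le>N. (g ^^ i) x \<in> J \<or> (h ^^ i) x \<in> J" if "good n J" for n J
    using that unfolding good_def by simp_all
  have "\<exists>J. good n J" for n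
  proof (induction n)
    case 0
    show ?case unfolding good_def by (rule exI[of _ "{}"]) (auto simp: step_fun_const)
  next
    case (Suc n)
    then obtain J where gJ: "good n J" by blast
    note J = goodD(1,2)[OF gJ] and dis = goodD(3)[OF gJ] and cov = goodD(4)[OF gJ]
    define K where "K = {x \<in> unit_interval. moved N g x \<and> real n * d \<le> x \<and> x < real (Suc n) * d \<and>
      (\<forall>i\<in>{0..N}. (g ^^ i) x \<notin> J \<and> (h ^^ i) x \<notin> J)}"
    have K: "x \<in> unit_interval" "moved N g x" "real n * d \<le> x" "x < real n * d + d"
      "i \<le> N \<Longrightarrow> (g ^^ i) x \<notin> J" "i \<le> N \<Longrightarrow> (h ^^ i) x \<notin> J" if "x \<in> K" for x i
      using that unfolding K_def by (auto simp: algebra_simps)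
    have sK: "step_fun D (\<lambda>x. x \<in> K)"
    proof -
      have s1: "step_fun D (\<lambda>x. \<forall>i\<in>{0..N}. (g ^^ i) x \<notin> J \<and> (h ^^ i) x \<notin> J)"
        by (intro step_fun_Ball step_fun_apply2[where F = "\<lambda>a b. \<not> a \<and> \<not> b"]
            step_fun_compose[OF exchange_funpow[OF g] J(1)]
            step_fun_compose[OF exchange_funpow[OF h] J(1)]) auto
      have s2: "step_fun D (\<lambda>x. \<not> x < real n * d \<and> x < real (Suc n) * d)"
        by (intro step_fun_apply2[where F = "\<lambda>a b. \<not> a \<and> b"] step_fun_less of_nat_mult_mem d)
      have "step_fun D (\<lambda>x. moved N g x \<and> (\<not> x < real n * d \<and> x < real (Suc n) * d) \<and>
        (\<forall>i\<in>{0..N}. (g ^^ i) x \<notin> J \<and> (h ^^ i) x \<notin> J))"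
        by (intro step_fun_apply2[where F = conj] step_fun_moved s1 s2)
      then show ?thesis
        by (rule step_fun_determined[of "{()}", rotated]) (auto simp: K_def not_less)
    qed
    have "step_fun D (\<lambda>x. x \<in> J \<union> K)"
      using step_fun_apply2[OF J(1) sK, where F = disj] by simp
    moreover have "J \<union> K \<subseteq> {x \<in> unit_interval. moved N g x}" using J(2) K(1,2) by blast
    moreover have "(g ^^ i) x \<notin> J \<union> K" if x: "x \<in> J \<union> K" and i: "i \<in> {1..N}" for x i
    proof
      assume gx: "(g ^^ i) x \<in> J \<union> K"
      have xI: "x \<in> unit_interval" "moved N g x" using x J(2) K(1,2) by blast+
      have inverse_pow: "(h ^^ i) ((g ^^ i) x) = x" using pow_cancel[OF xI(1), of i i] by simp
      have iN: "i \<le> N" using i by simp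
      have "\<not> (x \<in> J \<and> (g ^^ i) x \<in> J)" using dis i by blast
      moreover have "\<not> (x \<in> K \<and> (g ^^ i) x \<in> J)" using K(5)[OF _ iN] by blast
      moreover have "\<not> (x \<in> J \<and> (g ^^ i) x \<in> K)" using K(6)[OF _ iN] inverse_pow by metis
      ultimately have xK: "x \<in> K" "(g ^^ i) x \<in> K" using x gx by blast+
      have "\<bar>(g ^^ i) x - x\<bar> < d" using K(3,4)[OF xK(1)] K(3,4)[OF xK(2)] by (auto simp: abs_if)
      moreover have "\<delta> \<le> \<bar>(g ^^ i) x - x\<bar>"
        by (rule \<delta>(2)[OF xI(1) i]) (use xI(2) i in \<open>auto simp: moved_def\<close>)
      ultimately show False using d by simp
    qed
    moreover have "\<exists>i\<le>N. (g ^^ i) x \<in> J \<union> K \<or> (h ^^ i) x \<in> J \<union> K"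
      if x: "x \<in> unit_interval" "moved N g x" "x < real (Suc n) * d" for x
    proof (cases "x < real n * d")
      case True
      then show ?thesis using cov[OF x(1,2)] by blast
    next
      case False
      show ?thesis
      proof (cases "\<forall>i\<in>{0..N}. (g ^^ i) x \<notin> J \<and> (h ^^ i) x \<notin> J")
        case True
        then have "x \<in> K" using x False unfolding K_def by auto
        then have "(g ^^ 0) x \<in> J \<union> K" by simp
        then show ?thesis by blast
      next
        case False
        then obtain i where "i \<in> {0..N}" "(g ^^ i) x \<in> J \<or> (h ^^ i) x \<in> J" by blast
        then show ?thesis by (intro exI[of _ i]) auto
      qed
    qed
    ultimately have "good (Suc n) (J \<union> K)" unfolding good_def by simp
    then show ?case by blast
  qed
  moreover obtain n where "1 < real n * d" using reals_Archimedean3[OF d(2)] by blast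
  ultimately obtain J where gJ: "good n J" by blast
  show ?thesis
  proof (rule that[OF goodD(1,2)[OF gJ]])
    show "\<forall>x\<in>J. \<forall>i\<in>{1..N}. (g ^^ i) x \<notin> J" using goodD(3)[OF gJ] by simp
    show "\<forall>x\<in>unit_interval. moved N g x \<longrightarrow> (\<exists>i\<le>N. (g ^^ i) x \<in> J \<or> (h ^^ i) x \<in> J)"
      using goodD(4)[OF gJ] \<open>1 < real n * d\<close> by simp
  qed
qed

lemma recurrence:
  assumes x: "x \<in> unit_interval" "moved N g x"
    and cov: "\<forall>x\<in>unit_interval. moved N g x \<longrightarrow> (\<exists>i\<le>N. (g ^^ i) x \<in> J \<or> (h ^^ i) x \<in> J)"
  shows "\<exists>i\<in>{1..2 * N + 1}. (g ^^ i) x \<in> J" "\<exists>i\<in>{1..2 * N + 1}. (h ^^ i) x \<in> J"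
proof -
  interpret S: exchange_pair D h g by (rule pair_swap)
  obtain i where i: "i \<le> N" "(g ^^ i) ((g ^^ (N + 1)) x) \<in> J \<or> (h ^^ i) ((g ^^ (N + 1)) x) \<in> J"
    using cov mem(1)[OF x(1)] moved_pow(1)[OF x(1), THEN iffD2, OF x(2)] by blast
  have "(g ^^ i) ((g ^^ (N + 1)) x) = (g ^^ (i + (N + 1))) x"
    by (simp only: funpow_add comp_apply)
  moreover have "(h ^^ i) ((g ^^ (N + 1)) x) = (g ^^ (N + 1 - i)) x"
    by (rule pow_cancel[OF x(1)]) (use i in simp)
  ultimately have "(g ^^ (i + (N + 1))) x \<in> J \<or> (g ^^ (N + 1 - i)) x \<in> J"
    using i(2) by (simp only:)
  moreover have "i + (N + 1) \<in> {1..2 * N + 1}" "N + 1 - i \<in> {1..2 * N + 1}" using i by auto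
  ultimately show "\<exists>i\<in>{1..2 * N + 1}. (g ^^ i) x \<in> J" by blast
  obtain i where i: "i \<le> N" "(g ^^ i) ((h ^^ (N + 1)) x) \<in> J \<or> (h ^^ i) ((h ^^ (N + 1)) x) \<in> J"
    using cov mem(2)[OF x(1)] moved_pow(2)[OF x(1), THEN iffD2, OF x(2)] by blast
  have "(h ^^ i) ((h ^^ (N + 1)) x) = (h ^^ (i + (N + 1))) x"
    by (simp only: funpow_add comp_apply)
  moreover have "(g ^^ i) ((h ^^ (N + 1)) x) = (h ^^ (N + 1 - i)) x"
    by (rule S.pow_cancel[OF x(1)]) (use i in simp)
  ultimately have "(h ^^ (i + (N + 1))) x \<in> J \<or> (h ^^ (N + 1 - i)) x \<in> J"
    using i(2) by (simp only: disj_commute)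
  moreover have "i + (N + 1) \<in> {1..2 * N + 1}" "N + 1 - i \<in> {1..2 * N + 1}" using i by auto
  ultimately show "\<exists>i\<in>{1..2 * N + 1}. (h ^^ i) x \<in> J" by blast
qed

end

lemma funpow_dvd_fixed:
  assumes "(f ^^ i) x = x" "i dvd n"
  shows "(f ^^ n) x = x"
proof -
  obtain k where "n = i * k" using assms(2) by blast
  moreover have "(f ^^ (i * k)) x = x" using assms(1) by (induction k) (auto simp: funpow_add)
  ultimately show ?thesis by simp
qed

theorem (in unit_subgroup) split_off_finite_order:
  assumes dense: "\<And>\<epsilon>. 0 < \<epsilon> \<Longrightarrow> \<exists>d\<in>D. 0 < d \<and> d < \<epsilon>" and g: "exchange D g"
  obtains J r p where "step_fun D (\<lambda>x. x \<in> J)" "J \<subseteq> unit_interval"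
    "\<forall>x\<in>J. \<forall>i\<in>{1..N}. (g ^^ i) x \<notin> J"
    "exchange D r" "\<forall>x. x \<notin> J \<longrightarrow> r x = x"
    "finite_order_exchange p (fact (2 * N + 1))" "\<forall>x\<in>unit_interval. g x = r (p x)"
proof -
  obtain h where h: "exchange D h" "\<And>x. x \<in> unit_interval \<Longrightarrow> g (h x) = x"
    "\<And>x. x \<in> unit_interval \<Longrightarrow> h (g x) = x"
    using exchange_inverse_exists[OF g] by metis
  interpret P: exchange_pair D g h by unfold_locales (fact g h)+
  interpret S: exchange_pair D h g by (rule P.pair_swap)
  obtain J where J: "step_fun D (\<lambda>x. x \<in> J)" "J \<subseteq> {x \<in> unit_interval. moved N g x}"
    "\<forall>x\<in>J. \<forall>i\<in>{1..N}. (g ^^ i) x \<notin> J"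
    "\<forall>x\<in>unit_interval. moved N g x \<longrightarrow> (\<exists>i\<le>N. (g ^^ i) x \<in> J \<or> (h ^^ i) x \<in> J)"
    by (rule P.disjoint_images_set[OF dense])
  define L where "L = 2 * N + 1"
  have JI: "J \<subseteq> unit_interval" using J(2) by blast
  have rec: "\<exists>i\<in>{1..L}. (g ^^ i) x \<in> J" "\<exists>i\<in>{1..L}. (h ^^ i) x \<in> J"
    if "x \<in> unit_interval" "moved N g x" for x
    unfolding L_def by (rule P.recurrence[OF that J(4)])+
  have ret: "\<exists>i\<in>{1..L}. (g ^^ i) x \<in> J" "\<exists>i\<in>{1..L}. (h ^^ i) x \<in> J" if "x \<in> J" for x
  proof -
    have "x \<in> unit_interval" "moved N g x" using that J(2) by auto
    from rec[OF this] show "\<exists>i\<in>{1..L}. (g ^^ i) x \<in> J" "\<exists>i\<in>{1..L}. (h ^^ i) x \<in> J" .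
  qed
  define r where "r = first_return L g J"
  define r' where "r' = first_return L h J"
  define p where "p = (\<lambda>x. r' (g x))"
  have r: "exchange D r" unfolding r_def by (rule P.exchange_first_return[OF JI J(1) ret])
  have r': "exchange D r'" unfolding r'_def by (rule S.exchange_first_return[OF JI J(1) ret(2,1)])
  have p: "exchange D p" unfolding p_def by (rule exchange_compose[OF r' g])
  have per: "\<exists>i\<in>{1..L}. (p ^^ i) x = x" if x: "x \<in> unit_interval" for x
    unfolding p_def r'_def
  proof (rule P.first_return_periodic[OF JI J(1) x ret])
    show "(\<exists>i\<in>{1..L}. (g ^^ i) x \<in> J) \<or> (\<exists>i\<in>{1..L}. (g ^^ i) x = x)"
    proof (cases "moved N g x")
      case False
      then obtain i where "i \<in> {1..N}" "(g ^^ i) x = x" unfolding moved_def by blast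
      moreover from this have "i \<in> {1..L}" unfolding L_def by simp
      ultimately show ?thesis by blast
    qed (use rec(1)[OF x] in blast)
  qed
  have fin: "finite_order_exchange p (fact L)"
  proof
    show "exchange UNIV p" by (rule exchange_mono[OF p]) simp
    show "(p ^^ fact L) x = x" if x: "x \<in> unit_interval" for x
    proof -
      obtain i where i: "i \<in> {1..L}" "(p ^^ i) x = x" using per[OF x] by blast
      have "i dvd fact L" by (rule dvd_fact) (use i(1) in auto)
      then show ?thesis by (rule funpow_dvd_fixed[where f = p, OF i(2)])
    qed
  qed simp
  show ?thesis
  proof (rule that[OF J(1) JI J(3) r])
    show "finite_order_exchange p (fact (2 * N + 1))" using fin unfolding L_def .
    show "\<forall>x\<in>unit_interval. g x = r (p x)"
    proof
      fix x assume x: "x \<in> unit_interval"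
      show "g x = r (p x)" unfolding r_def p_def r'_def
        by (rule S.first_return_inverse[OF JI exchange_mem[OF g x] ret(2), symmetric])
    qed
    show "\<forall>x. x \<notin> J \<longrightarrow> r x = x" unfolding r_def first_return_def by simp
  qed
qed

section \<open>Collecting a set of small measure at the left end\<close>

text \<open>The cells of \<open>J\<close> are moved one after the other, from left to right, next to those already
  collected in \<open>[0, t)\<close>. Here \<open>b\<close> is the right end of the part of \<open>[0, 1)\<close> treated so far.\<close>

lemma (in unit_subgroup) collect_aux:
  assumes "finite E"
  shows "b \<in> D \<Longrightarrow> 0 \<le> b \<Longrightarrow> b \<le> 1 \<Longrightarrow> E \<subseteq> D \<Longrightarrow> (\<forall>e\<in>E. 0 \<le> e \<and> e < b) \<Longrightarrow>
    (\<forall>x y. 0 \<le> x \<and> x \<le> y \<and> y < b \<and> E \<inter> {x<..y} = {} \<longrightarrow> (x \<in> J) = (y \<in> J)) \<Longrightarrow>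
    \<exists>f t. exchange D f \<and> t \<in> D \<and> 0 \<le> t \<and> t \<le> b \<and> (\<forall>x\<ge>b. f x = x) \<and>
      (\<forall>x. 0 \<le> x \<and> x < b \<longrightarrow> f x < b \<and> ((x \<in> J) = (f x < t)))"
  using assms
proof (induction E arbitrary: b rule: finite_linorder_max_induct)
  case empty
  then have c: "(x \<in> J) = (0 \<in> J)" if "0 \<le> x" "x < b" for x using that by auto
  show ?case
    by (intro exI[of _ "\<lambda>x. x"] exI[of _ "if 0 \<in> J then b else 0"])
      (use c empty.prems exchange_id zero_mem in auto)
next
  case (insert c A)
  have c: "c \<in> D" "0 \<le> c" "c \<le> 1" "c < b" using insert.prems by auto
  have "(x \<in> J) = (y \<in> J)" if "0 \<le> x \<and> x \<le> y \<and> y < c \<and> A \<inter> {x<..y} = {}" for x y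
  proof -
    have "insert c A \<inter> {x<..y} = {}" using that by auto
    then show ?thesis using insert.prems(6) that c by auto
  qed
  then have "\<exists>f t. exchange D f \<and> t \<in> D \<and> 0 \<le> t \<and> t \<le> c \<and> (\<forall>x\<ge>c. f x = x) \<and>
      (\<forall>x. 0 \<le> x \<and> x < c \<longrightarrow> f x < c \<and> ((x \<in> J) = (f x < t)))"
    using insert.prems insert.hyps c by (intro insert.IH) auto
  then obtain f t where f: "exchange D f" "t \<in> D" "0 \<le> t" "t \<le> c" "\<forall>x\<ge>c. f x = x"
    "\<forall>x. 0 \<le> x \<and> x < c \<longrightarrow> f x < c \<and> ((x \<in> J) = (f x < t))" by blast
  have J: "(x \<in> J) = (c \<in> J)" if "c \<le> x" "x < b" for x
  proof -
    have "insert c A \<inter> {c<..x} = {}" using insert.hyps by auto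
    then show ?thesis using insert.prems(6) that c by auto
  qed
  show ?case
  proof (cases "c \<in> J")
    case False
    have "f x < b \<and> ((x \<in> J) = (f x < t))" if "0 \<le> x" "x < b" for x
      using f(4,5,6) that False J[of x] c by (cases "x < c") force+
    then show ?thesis using f c by (intro exI[of _ f] exI[of _ t]) auto
  next
    case True
    let ?s = "swap_intervals t (c - t) (b - c)"
    have s: "exchange D ?s"
      by (rule exchange_swap_intervals) (use f c insert.prems diff_mem in auto)
    have "?s (f x) < b \<and> ((x \<in> J) = (?s (f x) < t + (b - c)))" if x: "0 \<le> x" "x < b" for x
    proof (cases "x < c")
      case x_c: True
      then show ?thesis using f(4,6) x c by (auto simp: swap_intervals_def)
    next
      case False
      then show ?thesis using f(4,5) x c True J[of x] by (auto simp: swap_intervals_def)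
    qed
    moreover have "?s (f x) = x" if "b \<le> x" for x
      using f(5) that c f(4) by (auto simp: swap_intervals_def)
    moreover have "t + (b - c) \<in> D" using f(2) c(1) insert.prems(1) diff_mem add_mem by blast
    ultimately show ?thesis using f(3,4) c exchange_compose[OF s f(1)]
      by (intro exI[of _ "\<lambda>x. ?s (f x)"] exI[of _ "t + (b - c)"]) auto
  qed
qed

lemma (in unit_subgroup) collect:
  assumes "step_fun D (\<lambda>x. x \<in> J)"
  obtains f t where "exchange D f" "t \<in> D" "0 \<le> t" "t \<le> 1"
    "\<forall>x\<in>unit_interval. x \<in> J \<longleftrightarrow> f x < t"
proof -
  obtain E where E: "finite E" "E \<subseteq> D" "const_off E (\<lambda>x. x \<in> J)"
    using assms by (rule step_funE)
  have "(x \<in> J) = (y \<in> J)" if "0 \<le> x \<and> x \<le> y \<and> y < 1 \<and> (E \<inter> unit_interval) \<inter> {x<..y} = {}" for x y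
  proof -
    have "E \<inter> {x<..y} = {}" using that by auto
    then show ?thesis using const_offD[OF E(3), of x y] that by simp
  qed
  then have "\<exists>f t. exchange D f \<and> t \<in> D \<and> 0 \<le> t \<and> t \<le> 1 \<and> (\<forall>x\<ge>1. f x = x) \<and>
      (\<forall>x. 0 \<le> x \<and> x < 1 \<longrightarrow> f x < 1 \<and> ((x \<in> J) = (f x < t)))"
    using E one_mem by (intro collect_aux[of "E \<inter> unit_interval"]) auto
  then obtain f t where "exchange D f" "t \<in> D" "0 \<le> t" "t \<le> 1"
    "\<forall>x. 0 \<le> x \<and> x < 1 \<longrightarrow> f x < 1 \<and> ((x \<in> J) = (f x < t))" by blast
  then show ?thesis using that[of f t] by simp
qed

lemma lmeasurable_step_set:
  assumes "step_fun D (\<lambda>x. x \<in> A)" "A \<subseteq> unit_interval"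
  shows "A \<in> lmeasurable"
proof -
  obtain E where E: "finite E" "E \<subseteq> D" "const_off E (\<lambda>x. x \<in> A)"
    using assms(1) by (rule step_funE)
  let ?I = "insert 0 (E \<inter> unit_interval)"
  let ?cell = "\<lambda>e. {e..<1} - (\<Union>d\<in>{d \<in> E. e < d}. {d..})"
  have cell: "x \<in> ?cell e \<longleftrightarrow> e \<le> x \<and> x < 1 \<and> E \<inter> {e<..x} = {}" for x e by force
  have "A = (\<Union>e\<in>?I \<inter> A. ?cell e)"
  proof (intro equalityI subsetI)
    fix x assume x: "x \<in> A"
    then have xI: "x \<in> unit_interval" using assms(2) by blast
    obtain e where e: "e \<in> ?I" "e \<le> x" "E \<inter> {e<..x} = {}" by (rule gap_start[OF E(1) xI])
    have "(e \<in> A) = (x \<in> A)" by (rule const_offD[OF E(3)]) (use e xI in auto)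
    moreover have "x \<in> ?cell e" unfolding cell using e xI by simp
    ultimately show "x \<in> (\<Union>e\<in>?I \<inter> A. ?cell e)" using e(1) x by blast
  next
    fix x assume "x \<in> (\<Union>e\<in>?I \<inter> A. ?cell e)"
    then obtain e where e: "e \<in> ?I" "e \<in> A" "x \<in> ?cell e" by blast
    have "(e \<in> A) = (x \<in> A)"
      by (rule const_offD[OF E(3)]) (use e(1) e(3)[unfolded cell] in auto)
    then show "x \<in> A" using e(2) by simp
  qed
  moreover have "(\<Union>e\<in>?I \<inter> A. ?cell e) \<in> sets borel"
    using E(1) by (intro sets.finite_UN sets.Diff) auto
  ultimately have "A \<in> sets borel" by simp
  then have "A \<in> sets lebesgue" by simp
  moreover have "bounded A" by (rule bounded_subset[of "{0..1}"]) (use assms(2) in auto)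
  ultimately show ?thesis by (intro bounded_set_imp_lmeasurable)
qed

lemma measure_exchange_image:
  assumes f: "exchange UNIV f" and A: "step_fun UNIV (\<lambda>x. x \<in> A)" "A \<subseteq> unit_interval"
  shows "f ` A \<in> lmeasurable \<and> measure lebesgue (f ` A) = measure lebesgue A"
proof -
  define V where "V = (\<lambda>x. f x - x) ` unit_interval"
  have V: "finite V" unfolding V_def by (rule step_fun_finite_range[OF exchangeD(2)[OF f]])
  define P where "P v = {x \<in> A. f x - x = v}" for v
  have P: "P v \<in> lmeasurable" for v
  proof (rule lmeasurable_step_set)
    show "step_fun UNIV (\<lambda>x. x \<in> P v)"
      using step_fun_apply2[OF A(1) exchangeD(2)[OF f], where F = "\<lambda>a d. a \<and> d = v"]
      by (simp add: P_def)
  qed (use A(2) in \<open>auto simp: P_def\<close>)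
  have img: "f ` P v = (+) v ` P v" for v unfolding P_def by force
  have m: "f ` P v \<in> lmeasurable" "measure lebesgue (f ` P v) = measure lebesgue (P v)" for v
    unfolding img using P[of v] by (auto simp: measure_translation measurable_translation)
  have un: "A = (\<Union>v\<in>V. P v)" using A(2) unfolding V_def P_def by blast
  have image_un: "f ` A = (\<Union>v\<in>V. f ` P v)" by (subst un) blast
  have d1: "disjoint_family_on P V" unfolding disjoint_family_on_def P_def by blast
  have inj: "inj_on f A" using bij_betw_imp_inj_on[OF exchangeD(1)[OF f]] A(2) by (rule inj_on_subset)
  have d2: "disjoint_family_on (\<lambda>v. f ` P v) V"
    unfolding disjoint_family_on_def
  proof (intro ballI impI)
    fix v w assume "v \<in> V" "w \<in> V" "v \<noteq> w"
    then have "P v \<inter> P w = {}" "P v \<subseteq> A" "P w \<subseteq> A" unfolding P_def by auto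
    then show "f ` P v \<inter> f ` P w = {}" using inj_on_image_Int[OF inj, of "P v" "P w"] by simp
  qed
  have "measure lebesgue (f ` A) = (\<Sum>v\<in>V. measure lebesgue (f ` P v))"
    unfolding image_un by (rule measure_finite_Union) (use V d2 fmeasurableD[OF m(1)] fmeasurableD2[OF m(1)] in auto)
  also have "\<dots> = (\<Sum>v\<in>V. measure lebesgue (P v))" using m(2) by simp
  also have "\<dots> = measure lebesgue (\<Union>v\<in>V. P v)"
    by (rule measure_finite_Union[symmetric]) (use V d1 fmeasurableD[OF P] fmeasurableD2[OF P] in auto)
  finally have "measure lebesgue (f ` A) = measure lebesgue A" using un by simp
  moreover have "f ` A \<in> lmeasurable" unfolding image_un by (rule fmeasurable.finite_UN) (use V m(1) in auto)
  ultimately show ?thesis by simp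
qed

text \<open>Exchanges preserve Lebesgue measure and \<open>[0, 1)\<close> has measure \<open>1\<close>.\<close>

lemma disjoint_images_measure:
  assumes g: "exchange UNIV g" and J: "step_fun UNIV (\<lambda>x. x \<in> J)" "J \<subseteq> unit_interval"
    and dis: "\<forall>x\<in>J. \<forall>i\<in>{1..N}. (g ^^ i) x \<notin> J"
  shows "real (Suc N) * measure lebesgue J \<le> 1"
proof -
  have gi: "exchange UNIV (g ^^ i)" for i by (rule full.exchange_funpow[OF g])
  have m: "(g ^^ i) ` J \<in> lmeasurable" "measure lebesgue ((g ^^ i) ` J) = measure lebesgue J" for i
    using measure_exchange_image[OF gi J] by auto
  have less: "(g ^^ i) ` J \<inter> (g ^^ j) ` J = {}" if "i < j" "j \<le> N" for i j
  proof (rule ccontr)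
    assume "\<not> ?thesis"
    then obtain x y where xy: "x \<in> J" "y \<in> J" "(g ^^ i) x = (g ^^ j) y" by blast
    have "(g ^^ j) y = (g ^^ (i + (j - i))) y" using that by simp
    then have "(g ^^ i) x = (g ^^ i) ((g ^^ (j - i)) y)" using xy(3) by (simp only: funpow_add comp_apply)
    then have "x = (g ^^ (j - i)) y"
      by (rule exchange_inj[OF gi _ exchange_mem[OF gi], rotated 2]) (use xy J(2) in auto)
    moreover have "j - i \<in> {1..N}" using that by auto
    ultimately show False using dis xy(1,2) by blast
  qed
  have dis: "disjoint_family_on (\<lambda>i. (g ^^ i) ` J) {..N}"
    unfolding disjoint_family_on_def
  proof (intro ballI impI)
    fix i j assume "i \<in> {..N}" "j \<in> {..N}" "i \<noteq> j"
    then show "(g ^^ i) ` J \<inter> (g ^^ j) ` J = {}"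
      using less[of i j] less[of j i] by (cases i j rule: linorder_cases) auto
  qed
  have "real (Suc N) * measure lebesgue J = (\<Sum>i\<in>{..N}. measure lebesgue ((g ^^ i) ` J))"
    using m(2) by simp
  also have "\<dots> = measure lebesgue (\<Union>i\<in>{..N}. (g ^^ i) ` J)"
    by (rule measure_finite_Union[symmetric]) (use dis fmeasurableD[OF m(1)] fmeasurableD2[OF m(1)] in auto)
  also have "\<dots> \<le> measure lebesgue {0..1::real}"
  proof (rule measure_mono_fmeasurable)
    show "(\<Union>i\<in>{..N}. (g ^^ i) ` J) \<subseteq> {0..1}"
    proof
      fix x assume "x \<in> (\<Union>i\<in>{..N}. (g ^^ i) ` J)"
      then obtain i y where "y \<in> J" "x = (g ^^ i) y" by blast
      then have "x \<in> unit_interval" using exchange_mem[OF gi, of y i] J(2) by blast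
      then show "x \<in> {0..1}" by simp
    qed
    show "(\<Union>i\<in>{..N}. (g ^^ i) ` J) \<in> sets lebesgue" using m(1) by blast
  qed auto
  finally show ?thesis by simp
qed

lemma collected_length:
  assumes f: "exchange UNIV f" and J: "step_fun UNIV (\<lambda>x. x \<in> J)" "J \<subseteq> unit_interval"
    and t: "0 \<le> t" "t \<le> 1" "\<forall>x\<in>unit_interval. x \<in> J \<longleftrightarrow> f x < t"
  shows "measure lebesgue J = t"
proof -
  have "f ` J = {0..<t}"
  proof (intro equalityI subsetI)
    fix y assume "y \<in> f ` J"
    then obtain x where x: "x \<in> J" "y = f x" by blast
    then have "x \<in> unit_interval" using J(2) by blast
    then show "y \<in> {0..<t}" using t(3) x exchange_mem[OF f, of x] by simp
  next
    fix y assume y: "y \<in> {0..<t}"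
    then have yI: "y \<in> unit_interval" using t(2) by simp
    obtain x where x: "x \<in> unit_interval" "f x = y" by (rule exchange_surj[OF f yI])
    then have "x \<in> J" using t(3) y by simp
    then show "y \<in> f ` J" using x(2) by blast
  qed
  then show ?thesis using measure_exchange_image[OF f J] t(1) by simp
qed

section \<open>Blockwise exchanges and bounded products of commutators\<close>

text \<open>The map that acts on the \<open>i\<close>-th of the \<open>M\<close> blocks \<open>[i / M, (i + 1) / M)\<close> as the copy of \<open>a i\<close> at
  scale \<open>1 / M\<close>. Only the values \<open>a i\<close> for \<open>i < M\<close> matter.\<close>

definition blocks :: "nat \<Rightarrow> (nat \<Rightarrow> real \<Rightarrow> real) \<Rightarrow> real \<Rightarrow> real" where
  "blocks M a x = (a (nat \<lfloor>real M * x\<rfloor>) (frac (real M * x)) + of_int \<lfloor>real M * x\<rfloor>) / real M"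

lemma blocks_at:
  assumes "0 < M" "y \<in> unit_interval"
  shows "blocks M a ((y + real i) / real M) = (a i y + real i) / real M"
proof -
  have e: "real M * ((y + real i) / real M) = y + real i" using assms by simp
  have f: "\<lfloor>y + real i\<rfloor> = int i" using assms(2) by (intro floor_unique) auto
  show ?thesis unfolding blocks_def e frac_def f by simp
qed

lemma block_mem:
  assumes "i < M" "y \<in> unit_interval"
  shows "(y + real i) / real M \<in> unit_interval"
proof -
  have "real i + 1 \<le> real M" using assms(1) by simp
  then have "0 \<le> y + real i" "y + real i < real M" using assms(2) by auto
  then show ?thesis using assms(1) by (simp add: divide_simps)
qed

lemma block_coords:
  assumes "0 < M" "x \<in> unit_interval"
  obtains i y where "i < M" "y \<in> unit_interval" "x = (y + real i) / real M"
proof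
  let ?i = "nat \<lfloor>real M * x\<rfloor>"
  have i: "real ?i = of_int \<lfloor>real M * x\<rfloor>" using assms by simp
  have "real M * x < real M" using assms by simp
  then have "of_int \<lfloor>real M * x\<rfloor> < real M" by linarith
  then show "?i < M" using i by linarith
  show "frac (real M * x) \<in> unit_interval" by (simp add: frac_lt_1)
  show "x = (frac (real M * x) + real ?i) / real M" using assms unfolding i frac_def by simp
qed

lemma exchange_blocks:
  assumes M: "0 < M" and a: "\<And>i. exchange UNIV (a i)"
  shows "exchange UNIV (blocks M a)"
  unfolding exchange_def
proof (intro conjI)
  have "\<forall>i. \<exists>b. exchange UNIV b \<and> (\<forall>x\<in>unit_interval. a i (b x) = x) \<and> (\<forall>x\<in>unit_interval. b (a i x) = x)"
  proof
    fix i
    obtain b where "exchange UNIV b" "\<And>x. x \<in> unit_interval \<Longrightarrow> a i (b x) = x"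
      "\<And>x. x \<in> unit_interval \<Longrightarrow> b (a i x) = x"
      using full.exchange_inverse_exists[OF a[of i]] by metis
    then show "\<exists>b. exchange UNIV b \<and> (\<forall>x\<in>unit_interval. a i (b x) = x) \<and> (\<forall>x\<in>unit_interval. b (a i x) = x)"
      by (intro exI[of _ b]) simp
  qed
  then obtain b where b: "\<forall>i. exchange UNIV (b i) \<and> (\<forall>x\<in>unit_interval. a i (b i x) = x) \<and>
      (\<forall>x\<in>unit_interval. b i (a i x) = x)" by metis
  have mem: "blocks M c x \<in> unit_interval"
    if c: "\<And>i. exchange UNIV (c i)" and x: "x \<in> unit_interval" for c x
  proof -
    obtain i y where iy: "i < M" "y \<in> unit_interval" "x = (y + real i) / real M"
      by (rule block_coords[OF M x])
    show ?thesis unfolding iy(3) blocks_at[OF M iy(2)]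
      by (rule block_mem[OF iy(1) exchange_mem[OF c iy(2)]])
  qed
  have inverse: "blocks M c (blocks M c' x) = x"
    if c: "\<And>i. exchange UNIV (c' i)" "\<And>i y. y \<in> unit_interval \<Longrightarrow> c i (c' i y) = y"
      and x: "x \<in> unit_interval" for c c' x
  proof -
    obtain i y where iy: "i < M" "y \<in> unit_interval" "x = (y + real i) / real M"
      by (rule block_coords[OF M x])
    show ?thesis
      unfolding iy(3) blocks_at[OF M iy(2)] blocks_at[OF M exchange_mem[OF c(1) iy(2)]]
        c(2)[OF iy(2)] ..
  qed
  show "bij_betw (blocks M a) unit_interval unit_interval"
  proof (rule bij_betwI[where g = "blocks M b"])
    show "blocks M a \<in> unit_interval \<rightarrow> unit_interval" by (rule funcsetI, rule mem[OF a])
    show "blocks M b \<in> unit_interval \<rightarrow> unit_interval"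
      by (rule funcsetI, rule mem) (use b in auto)
    show "blocks M b (blocks M a x) = x" if "x \<in> unit_interval" for x
      by (rule inverse[OF a _ that]) (use b in simp)
    show "blocks M a (blocks M b x) = x" if "x \<in> unit_interval" for x
      by (rule inverse[OF _ _ that]) (use b in simp_all)
  qed
  have "\<forall>i. \<exists>E. finite E \<and> const_off E (\<lambda>x. a i x - x)"
    using exchangeD(2)[OF a] unfolding step_fun_def by blast
  then obtain E where E: "\<forall>i. finite (E i) \<and> const_off (E i) (\<lambda>x. a i x - x)" by metis
  let ?F = "\<Union>i\<in>{..<M}. (\<lambda>e. (e + real i) / real M) ` insert 0 (E i)"
  show "step_fun UNIV (\<lambda>x. blocks M a x - x)"
  proof (rule step_funI[of ?F])
    show "finite ?F" using E by simp
    fix x y :: real assume xy: "0 \<le> x" "x \<le> y" "y < 1" "?F \<inter> {x<..y} = {}"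
    obtain i u where u: "i < M" "u \<in> unit_interval" "x = (u + real i) / real M"
      by (rule block_coords[OF M, of x]) (use xy in auto)
    obtain j v where v: "j < M" "v \<in> unit_interval" "y = (v + real j) / real M"
      by (rule block_coords[OF M, of y]) (use xy in auto)
    have F: "(e + real k) / real M \<in> ?F" if "k < M" "e \<in> insert 0 (E k)" for k e
      using that by blast
    have le: "u + real i \<le> v + real j" using xy(2) u v M by (simp add: divide_simps)
    have "\<not> j < i"
    proof
      assume "j < i"
      then have "real j + 1 \<le> real i" by simp
      then show False using le u(2) v(2) by auto
    qed
    moreover have "\<not> i < j"
    proof
      assume "i < j"
      then have "real i + 1 \<le> real j" by simp
      then have "(0 + real j) / real M \<in> {x<..y}"
        using u v M by (auto simp: divide_strict_right_mono divide_right_mono)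
      moreover have "(0 + real j) / real M \<in> ?F" by (rule F) (use v in auto)
      ultimately show False using xy(4) by blast
    qed
    ultimately have ij: "i = j" by simp
    have "E i \<inter> {u<..v} = {}"
    proof (rule ccontr)
      assume "\<not> ?thesis"
      then obtain e where e: "e \<in> E i" "u < e" "e \<le> v" by auto
      then have "(e + real i) / real M \<in> {x<..y}"
        using u v M ij by (auto simp: divide_strict_right_mono divide_right_mono)
      moreover have "(e + real i) / real M \<in> ?F" by (rule F) (use u e in auto)
      ultimately show False using xy(4) by blast
    qed
    then have "a i u - u = a i v - v"
      using const_offD[of "E i" "\<lambda>x. a i x - x" u v] E u(2) v(2) le ij by auto
    then show "blocks M a x - x = blocks M a y - y"
      unfolding u(3) v(3) blocks_at[OF M u(2)] blocks_at[OF M v(2)]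
      by (simp add: ij diff_divide_distrib[symmetric])
  qed simp
qed simp

abbreviation block_iet :: "nat \<Rightarrow> (nat \<Rightarrow> real \<Rightarrow> real) \<Rightarrow> real \<Rightarrow> real" where
  "block_iet M a \<equiv> iet_of (blocks M a)"

lemma iet_blocks: "0 < M \<Longrightarrow> (\<And>i. a i \<in> iet) \<Longrightarrow> block_iet M a \<in> iet"
  by (rule iet_restrict[OF exchange_blocks]) (auto intro: exchange_of_iet)

lemma mult_blocks:
  assumes M: "0 < M" and a: "\<And>i. a i \<in> iet" and b: "\<And>i. b i \<in> iet"
  shows "block_iet M a \<otimes>\<^bsub>G\<^esub> block_iet M b = block_iet M (\<lambda>i. a i \<otimes>\<^bsub>G\<^esub> b i)"
proof -
  have "blocks M a (blocks M b x) = blocks M (\<lambda>i. a i \<otimes>\<^bsub>G\<^esub> b i) x"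
    if x: "x \<in> unit_interval" for x
  proof -
    obtain i y where iy: "i < M" "y \<in> unit_interval" "x = (y + real i) / real M"
      by (rule block_coords[OF M x])
    show ?thesis
      unfolding iy(3) blocks_at[OF M iy(2)] blocks_at[OF M iet_mem[OF b iy(2)]]
        mult_G_apply[OF a b iy(2)] ..
  qed
  then have "iet_of (\<lambda>x. blocks M a (blocks M b x)) = block_iet M (\<lambda>i. a i \<otimes>\<^bsub>G\<^esub> b i)"
    by (rule restrict_ext)
  moreover have "block_iet M a \<otimes>\<^bsub>G\<^esub> block_iet M b = iet_of (\<lambda>x. blocks M a (blocks M b x))"
    by (rule mult_iet_of) (auto intro: exchange_blocks[OF M] exchange_of_iet a b)
  ultimately show ?thesis by simp
qed

lemma blocks_commutator:
  assumes M: "0 < M" and e: "\<And>i. e i \<in> derived_set G (carrier G)"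
  shows "block_iet M e \<in> derived_set G (carrier G)"
proof -
  have "\<forall>i. \<exists>x\<in>iet. \<exists>y\<in>iet. e i = x \<otimes>\<^bsub>G\<^esub> y \<otimes>\<^bsub>G\<^esub> inv\<^bsub>G\<^esub> x \<otimes>\<^bsub>G\<^esub> inv\<^bsub>G\<^esub> y"
    using e by auto
  then obtain x y where xy: "\<And>i. x i \<in> iet" "\<And>i. y i \<in> iet"
    "\<And>i. e i = x i \<otimes>\<^bsub>G\<^esub> y i \<otimes>\<^bsub>G\<^esub> inv\<^bsub>G\<^esub> (x i) \<otimes>\<^bsub>G\<^esub> inv\<^bsub>G\<^esub> (y i)" by metis
  have ei: "e i \<in> iet" for i using G.derived_set_carrier e[of i] by auto
  have eq: "x i \<otimes>\<^bsub>G\<^esub> y i = e i \<otimes>\<^bsub>G\<^esub> y i \<otimes>\<^bsub>G\<^esub> x i" for i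
    unfolding xy(3) using xy(1,2)[of i] by (simp add: G.m_assoc)
  show ?thesis
  proof (rule G.commutatorI)
    show "block_iet M x \<in> carrier G" "block_iet M y \<in> carrier G" "block_iet M e \<in> carrier G"
      using iet_blocks[OF M] xy(1,2) ei by auto
    have "block_iet M e \<otimes>\<^bsub>G\<^esub> block_iet M y \<otimes>\<^bsub>G\<^esub> block_iet M x = block_iet M (\<lambda>i. (e i \<otimes>\<^bsub>G\<^esub> y i) \<otimes>\<^bsub>G\<^esub> x i)"
      unfolding mult_blocks[of M e y, OF M ei xy(2)]
      by (rule mult_blocks[OF M _ xy(1)]) (use G.m_closed ei xy(2) in simp)
    then show "block_iet M x \<otimes>\<^bsub>G\<^esub> block_iet M y = block_iet M e \<otimes>\<^bsub>G\<^esub> block_iet M y \<otimes>\<^bsub>G\<^esub> block_iet M x"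
      unfolding mult_blocks[of M x y, OF M xy(1,2)] by (simp add: eq)
  qed
qed

text \<open>The cyclic shift of the blocks, which is the rotation by \<open>1 / M\<close>.\<close>

definition block_shift :: "nat \<Rightarrow> real \<Rightarrow> real" where
  "block_shift M = swap_intervals 0 (1 - 1 / real M) (1 / real M)"

lemma exchange_block_shift: "0 < M \<Longrightarrow> exchange UNIV (block_shift M)"
  unfolding block_shift_def by (rule full.exchange_swap_intervals) auto

lemma block_shift_at:
  assumes "i < M" "y \<in> unit_interval"
  shows "block_shift M ((y + real i) / real M) =
    (y + real (if Suc i < M then Suc i else 0)) / real M"
proof (cases "Suc i < M")
  case True
  have "real i + 2 \<le> real M" using True by simp
  then have "y + real i < real M - 1" using assms by auto
  then have "(y + real i) / real M < (real M - 1) / real M"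
    using assms by (intro divide_strict_right_mono) auto
  then have "(y + real i) / real M < 1 - 1 / real M" using assms by (simp add: diff_divide_distrib)
  moreover have "0 \<le> (y + real i) / real M" using assms by simp
  ultimately show ?thesis using True unfolding block_shift_def swap_intervals_def
    by (simp add: add_divide_distrib)
next
  case False
  then have M: "real M = real i + 1" using assms by simp
  then have e: "1 - 1 / real M = real i / real M" by (simp add: field_simps)
  have "real i / real M \<le> (y + real i) / real M"
    using assms by (intro divide_right_mono) auto
  moreover have "(y + real i) / real M < (real i + 1) / real M"
    using assms by (intro divide_strict_right_mono) auto
  ultimately show ?thesis using False unfolding block_shift_def swap_intervals_def e
    by (simp add: add_divide_distrib)
qed

text \<open>A product \<open>k\<^sub>1 \<cdots> k\<^sub>n\<close> of \<open>n < M\<close> commutators, placed in the first of \<open>M\<close> blocks, is a product of two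
  commutators. The blockwise map \<open>(1, k\<^sub>1, \<dots>, k\<^sub>n, 1, \<dots>)\<close> is one commutator because commutators can be
  formed blockwise. The blockwise map \<open>(k\<^sub>1 \<cdots> k\<^sub>n, k\<^sub>1\<^sup>-\<^sup>1, \<dots>, k\<^sub>n\<^sup>-\<^sup>1, 1, \<dots>)\<close> is the commutator of the
  blockwise map of tails \<open>(k\<^sub>1 \<cdots> k\<^sub>n, k\<^sub>2 \<cdots> k\<^sub>n, \<dots>, k\<^sub>n, 1, \<dots>)\<close> with the shift; \<open>n < M\<close> ensures
  that the tail in the last block is trivial.\<close>

theorem first_block_two_commutators:
  assumes ks: "set ks \<subseteq> derived_set G (carrier G)" "length ks < M"
  shows "product_of_commutators G 2
    (block_iet M (\<lambda>i. if i = 0 then foldr (\<lambda>x y. x \<otimes>\<^bsub>G\<^esub> y) ks \<one>\<^bsub>G\<^esub> else \<one>\<^bsub>G\<^esub>))"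
proof -
  have M: "0 < M" using ks(2) by simp
  define t where "t i = foldr (\<lambda>x y. x \<otimes>\<^bsub>G\<^esub> y) (drop i ks) \<one>\<^bsub>G\<^esub>" for i
  define e where "e i = (if 0 < i \<and> i \<le> length ks then ks ! (i - 1) else \<one>\<^bsub>G\<^esub>)" for i
  define d where "d i = (if i = 0 then t 0 else inv\<^bsub>G\<^esub> (e i))" for i
  have ksG: "set ks \<subseteq> iet" using subset_trans[OF ks(1) G.derived_set_carrier] by simp
  have t: "t i \<in> iet" for i
    unfolding t_def using G.foldr_mult_closed[of "drop i ks"] ksG set_drop_subset[of i ks] by auto
  have one: "\<one>\<^bsub>G\<^esub> \<in> derived_set G (carrier G)"
    by (rule G.commutatorI[of "\<one>\<^bsub>G\<^esub>" "\<one>\<^bsub>G\<^esub>"]) simp_all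
  have e: "e i \<in> derived_set G (carrier G)" for i
  proof (cases "0 < i \<and> i \<le> length ks")
    case True
    then have "ks ! (i - 1) \<in> set ks" by (intro nth_mem) auto
    moreover have "e i = ks ! (i - 1)" using True by (simp add: e_def)
    ultimately show ?thesis using ks(1) by (simp only: subsetD)
  next
    case False
    then have "e i = \<one>\<^bsub>G\<^esub>" unfolding e_def by (rule if_not_P)
    then show ?thesis using one by (simp only:)
  qed
  have ei: "e i \<in> iet" for i using G.derived_set_carrier e[of i] by auto
  have d: "d i \<in> iet" for i unfolding d_def using t ei G.inv_closed by simp
  have te: "t i = e (Suc i) \<otimes>\<^bsub>G\<^esub> t (Suc i)" for i
  proof (cases "i < length ks")
    case True
    then show ?thesis unfolding t_def e_def by (simp flip: Cons_nth_drop_Suc)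
  next
    case False
    then show ?thesis unfolding t_def e_def by simp
  qed
  have dt: "d (Suc i) \<otimes>\<^bsub>G\<^esub> t i = t (Suc i)" for i
  proof -
    have "d (Suc i) \<otimes>\<^bsub>G\<^esub> t i = inv\<^bsub>G\<^esub> (e (Suc i)) \<otimes>\<^bsub>G\<^esub> (e (Suc i) \<otimes>\<^bsub>G\<^esub> t (Suc i))"
      unfolding te[symmetric] by (simp add: d_def)
    also have "\<dots> = t (Suc i)" using ei[of "Suc i"] t[of "Suc i"] by (simp flip: G.m_assoc)
    finally show ?thesis .
  qed
  have last: "t (M - 1) = \<one>\<^bsub>G\<^esub>" unfolding t_def using ks(2) by simp
  have "block_iet M d \<in> derived_set G (carrier G)"
  proof (rule G.commutatorI)
    let ?r = "block_shift M"
    have r: "exchange UNIV ?r" by (rule exchange_block_shift[OF M])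
    have bt: "exchange UNIV (blocks M t)" and bd: "exchange UNIV (blocks M d)"
      by (auto intro: exchange_blocks[OF M] exchange_of_iet t d)
    show "block_iet M t \<in> carrier G" "iet_of ?r \<in> carrier G" "block_iet M d \<in> carrier G"
      using iet_restrict bt bd r by auto
    have "blocks M t (?r x) = blocks M d (?r (blocks M t x))" if x: "x \<in> unit_interval" for x
    proof -
      obtain i y where iy: "i < M" "y \<in> unit_interval" "x = (y + real i) / real M"
        by (rule block_coords[OF M x])
      have ty: "t i y \<in> unit_interval" by (rule iet_mem[OF t iy(2)])
      show ?thesis
      proof (cases "Suc i < M")
        case True
        have "t (Suc i) y = d (Suc i) (t i y)"
          unfolding dt[symmetric] by (rule mult_G_apply[OF d t iy(2)])
        then show ?thesis
          unfolding iy(3) blocks_at[OF M iy(2)] block_shift_at[OF iy(1,2)]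
            block_shift_at[OF iy(1) ty] blocks_at[OF M ty] using True by simp
      next
        case False
        then have "i = M - 1" using iy(1) by simp
        then have "t i y = y" using last one_G_apply[OF iy(2)] by simp
        then show ?thesis
          unfolding iy(3) blocks_at[OF M iy(2)] block_shift_at[OF iy(1,2)]
            block_shift_at[OF iy(1) ty] blocks_at[OF M ty] using False by (simp add: d_def)
      qed
    qed
    then have "iet_of (\<lambda>x. blocks M t (?r x)) = iet_of (\<lambda>x. blocks M d (?r (blocks M t x)))"
      by (rule restrict_ext)
    then show "block_iet M t \<otimes>\<^bsub>G\<^esub> iet_of ?r = block_iet M d \<otimes>\<^bsub>G\<^esub> iet_of ?r \<otimes>\<^bsub>G\<^esub> block_iet M t"
      by (simp only: mult_iet_of bt bd r full.exchange_compose[OF bd r])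
  qed
  moreover have "block_iet M e \<in> derived_set G (carrier G)" by (rule blocks_commutator[OF M e])
  ultimately have "product_of_commutators G (1 + 1) (block_iet M d \<otimes>\<^bsub>G\<^esub> block_iet M e)"
    by (intro G.product_of_commutators_mult G.product_of_commutators_one)
  moreover have "block_iet M d \<otimes>\<^bsub>G\<^esub> block_iet M e = block_iet M (\<lambda>i. d i \<otimes>\<^bsub>G\<^esub> e i)"
    by (rule mult_blocks[OF M d ei])
  moreover have "d i \<otimes>\<^bsub>G\<^esub> e i = (if i = 0 then t 0 else \<one>\<^bsub>G\<^esub>)" for i
    using ei[of i] t[of 0] unfolding d_def by (auto simp: e_def)
  ultimately have "product_of_commutators G 2 (block_iet M (\<lambda>i. if i = 0 then t 0 else \<one>\<^bsub>G\<^esub>))"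
    by (simp add: numeral_2_eq_2)
  moreover have "t 0 = foldr (\<lambda>x y. x \<otimes>\<^bsub>G\<^esub> y) ks \<one>\<^bsub>G\<^esub>" by (simp add: t_def)
  ultimately show ?thesis by (simp only:)
qed

section \<open>Generation by swaps\<close>

abbreviation iet_swap :: "real \<Rightarrow> real \<Rightarrow> real \<Rightarrow> real \<Rightarrow> real" where
  "iet_swap u a b \<equiv> iet_of (swap_intervals u a b)"

lemma exchange_swap:
  "0 \<le> u \<Longrightarrow> 0 \<le> a \<Longrightarrow> 0 \<le> b \<Longrightarrow> u + a + b \<le> 1 \<Longrightarrow> exchange UNIV (swap_intervals u a b)"
  by (rule full.exchange_swap_intervals) auto

lemma iet_swap_mem: "0 \<le> u \<Longrightarrow> 0 \<le> a \<Longrightarrow> 0 \<le> b \<Longrightarrow> u + a + b \<le> 1 \<Longrightarrow> iet_swap u a b \<in> iet"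
  by (rule iet_restrict[OF exchange_swap])

lemma swap_swap: "0 \<le> a \<Longrightarrow> 0 \<le> b \<Longrightarrow> swap_intervals u b a (swap_intervals u a b x) = x"
  by (auto simp: swap_intervals_def)

text \<open>An exchange that is the identity on \<open>[0, t)\<close> is turned by a swap into one that is the identity on a
  longer interval: the cell \<open>[u, v)\<close> that is sent to the right of \<open>t\<close> is first moved there. The set \<open>E\<close>
  contains \<open>1\<close>, so that the number of its points right of \<open>t\<close> decreases even when \<open>[u, v)\<close> is the last
  cell.\<close>

lemma exchange_decompose:
  assumes one: "P \<one>\<^bsub>G\<^esub>"
    and step: "\<And>f u a b. f \<in> iet \<Longrightarrow> P f \<Longrightarrow> 0 \<le> u \<Longrightarrow> 0 \<le> a \<Longrightarrow> 0 \<le> b \<Longrightarrow> u + a + b \<le> 1 \<Longrightarrow>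
      P (f \<otimes>\<^bsub>G\<^esub> iet_swap u a b)"
    and f: "exchange UNIV f" and E: "finite E" "1 \<in> E" "const_off E (\<lambda>x. f x - x)"
    and t: "0 \<le> t" "t \<le> 1" and fix_t: "\<And>x. 0 \<le> x \<Longrightarrow> x < t \<Longrightarrow> f x = x"
  shows "P (iet_of f)"
  using f E t fix_t
proof (induction "card (E \<inter> {t<..1})" arbitrary: f E t rule: less_induct)
  case less
  note f = less.prems(1) and E = less.prems(2-4) and t = less.prems(5,6) and fix_t = less.prems(7)
  show ?case
  proof (cases "t < 1")
    case False
    then have "f x = x" if "x \<in> unit_interval" for x using fix_t[of x] that t by simp
    then have "iet_of f = \<one>\<^bsub>G\<^esub>" unfolding one_G by (rule restrict_ext)
    then show ?thesis using one by simp
  next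
    case True
    then have tI: "t \<in> unit_interval" using t by simp
    obtain u where u: "u \<in> unit_interval" "f u = t" by (rule exchange_surj[OF f tI])
    have tu: "t \<le> u" using fix_t[of u] u by force
    \<comment> \<open>Otherwise points slightly to the left of \<open>u\<close> would be sent to the left of \<open>t\<close>, where \<open>f\<close> is the identity.\<close>
    have uE: "u \<in> E" if "t < u"
    proof (rule ccontr)
      assume "u \<notin> E"
      obtain e where e: "e \<in> insert 0 (E \<inter> unit_interval)" "e \<le> u" "E \<inter> {e<..u} = {}"
        by (rule gap_start[OF E(1) u(1)])
      then have "e < u" using \<open>u \<notin> E\<close> that t by (cases "e = u") auto
      let ?z = "max e t"
      have z: "?z \<in> unit_interval" "?z < u" using \<open>e < u\<close> that t u(1) by auto
      have "E \<inter> {?z<..u} = {}" using e(3) by auto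
      then have "f ?z - ?z = f u - u" using const_offD[OF E(3), of ?z u] z u(1) by simp
      then have fz: "f ?z < t" using u(2) z(2) by linarith
      have "f (f ?z) = f ?z" by (rule fix_t) (use fz exchange_mem[OF f z(1)] in auto)
      then have "f ?z = ?z" using exchange_inj[OF f exchange_mem[OF f z(1)] z(1)] by simp
      then show False using fz by simp
    qed
    define v where "v = Min {e \<in> E. u < e}"
    have fin: "finite {e \<in> E. u < e}" "1 \<in> {e \<in> E. u < e}" using E u(1) by auto
    have "v \<in> {e \<in> E. u < e}" unfolding v_def by (rule Min_in) (use fin in auto)
    then have v: "v \<in> E" "u < v" by auto
    have vmin: "v \<le> e" if "e \<in> E" "u < e" for e unfolding v_def by (rule Min_le) (use fin that in auto)
    have v1: "v \<le> 1" using vmin[of 1] fin by simp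
    have fu: "f x = x - u + t" if "u \<le> x" "x < v" for x
    proof -
      have "E \<inter> {u<..x} = {}" using vmin that by force
      then show ?thesis using const_offD[OF E(3), of u x] that u v1 by auto
    qed
    define c where "c = v - u"
    let ?s = "swap_intervals t (u - t) c" and ?r = "swap_intervals t c (u - t)"
    define f' where "f' = (\<lambda>x. f (?r x))"
    have f': "exchange UNIV f'" unfolding f'_def
      by (rule full.exchange_compose[OF f exchange_swap]) (use t tu v v1 c_def in auto)
    have s: "exchange UNIV ?s" by (rule exchange_swap) (use t tu v v1 c_def in auto)
    have "(\<lambda>x. f' (?s x)) = f"
      unfolding f'_def using swap_swap[of "u - t" c t] tu v by (simp add: c_def)
    then have dec: "iet_of f = iet_of f' \<otimes>\<^bsub>G\<^esub> iet_swap t (u - t) c"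
      unfolding mult_iet_of[OF f' s] by simp
    define A where "A = E \<inter> {t<..<u}"
    define B where "B = E \<inter> {v..1}"
    define E' where "E' = insert (t + c) ((\<lambda>e. e + c) ` A \<union> B)"
    have "P (iet_of f')"
    proof (rule less.hyps)
      show "exchange UNIV f'" by (rule f')
      show "finite E'" "1 \<in> E'" unfolding E'_def A_def B_def using E v1 by auto
      show "0 \<le> t + c" "t + c \<le> 1" using t tu v v1 c_def by auto
      show f'_fix: "f' x = x" if "0 \<le> x" "x < t + c" for x
        using that fix_t[of x] fu[of "x + (u - t)"] tu
        by (auto simp: f'_def swap_intervals_def c_def)
      show "const_off E' (\<lambda>x. f' x - x)"
        unfolding const_off_def
      proof (intro allI impI)
        fix x y :: real assume xy: "0 \<le> x \<and> x \<le> y \<and> y < 1 \<and> E' \<inter> {x<..y} = {}"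
        have notin: "e \<notin> {x<..y}" if "e \<in> E'" for e using that xy by blast
        have tc: "t + c \<notin> {x<..y}" by (rule notin) (simp add: E'_def)
        have vE: "v \<notin> {x<..y}" by (rule notin) (use v v1 in \<open>simp add: E'_def B_def\<close>)
        consider "y < t + c" | "t + c \<le> x" "y < v" | "v \<le> x" using tc vE xy by force
        then show "f' x - x = f' y - y"
        proof cases
          case 1
          then show ?thesis using f'_fix xy by auto
        next
          case 2
          have r: "?r z = z - c" if "x \<le> z" "z \<le> y" for z
            using 2 that v tu by (auto simp: swap_intervals_def c_def)
          have "E \<inter> {x - c<..y - c} = {}"
          proof (rule ccontr)
            assume "\<not> ?thesis"
            then obtain e where e: "e \<in> E" "x - c < e" "e \<le> y - c" by auto
            then have "e \<in> A" using 2 by (auto simp: A_def c_def)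
            then have "e + c \<in> E'" unfolding E'_def by blast
            then show False using notin[of "e + c"] e by auto
          qed
          then have "f (x - c) - (x - c) = f (y - c) - (y - c)"
            using const_offD[OF E(3), of "x - c" "y - c"] 2 t xy v tu by (auto simp: c_def)
          then show ?thesis using r[of x] r[of y] xy by (simp add: f'_def)
        next
          case 3
          have r: "?r z = z" if "x \<le> z" for z
            using 3 that tu by (auto simp: swap_intervals_def c_def)
          have "E \<inter> {x<..y} = {}"
          proof (rule ccontr)
            assume "\<not> ?thesis"
            then obtain e where e: "e \<in> E" "x < e" "e \<le> y" by auto
            then have "e \<in> B" using 3 xy by (auto simp: B_def)
            then have "e \<in> E'" unfolding E'_def by blast
            then show False using notin[of e] e by auto
          qed
          then show ?thesis
            using const_offD[OF E(3), of x y] xy r[of x] r[of y] by (simp add: f'_def)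
        qed
      qed
      have finAB: "finite A" "finite B" unfolding A_def B_def using E(1) by auto
      have finE: "finite (E \<inter> {t<..1})" using E(1) by simp
      show "card (E' \<inter> {t + c<..1}) < card (E \<inter> {t<..1})"
      proof (cases "t < u")
        case True
        have dis: "A \<inter> B = {}" unfolding A_def B_def using v by auto
        have "u \<notin> A \<union> B" unfolding A_def B_def using v by auto
        moreover have "insert u (A \<union> B) \<subseteq> E \<inter> {t<..1}"
          unfolding A_def B_def using uE[OF True] True u(1) v tu by auto
        ultimately have "A \<union> B \<subset> E \<inter> {t<..1}" by blast
        then have "card (A \<union> B) < card (E \<inter> {t<..1})" by (rule psubset_card_mono[OF finE])
        moreover have "card (E' \<inter> {t + c<..1}) \<le> card ((\<lambda>e. e + c) ` A \<union> B)"
          by (rule card_mono) (use finAB in \<open>auto simp: E'_def\<close>)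
        moreover have "card ((\<lambda>e. e + c) ` A \<union> B) \<le> card ((\<lambda>e. e + c) ` A) + card B"
          by (rule card_Un_le)
        moreover have "card ((\<lambda>e. e + c) ` A) \<le> card A" by (rule card_image_le[OF finAB(1)])
        moreover have "card (A \<union> B) = card A + card B" by (rule card_Un_disjoint[OF finAB dis])
        ultimately show ?thesis by linarith
      next
        case False
        then have ut: "u = t" using tu by simp
        have "E' \<inter> {t + c<..1} \<subseteq> E \<inter> {t<..1}"
          unfolding E'_def A_def B_def using ut v(2) by (auto simp: c_def)
        moreover have "v \<in> E \<inter> {t<..1}" "v \<notin> E' \<inter> {t + c<..1}"
          using v v1 ut by (auto simp: c_def)
        ultimately have "E' \<inter> {t + c<..1} \<subset> E \<inter> {t<..1}" by blast
        then show ?thesis by (rule psubset_card_mono[OF finE])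
      qed
    qed
    then show ?thesis unfolding dec
      by (intro step iet_restrict[OF f']) (use t tu v v1 c_def in auto)
  qed
qed

lemma iet_swap_induct [consumes 1, case_names one swap]:
  assumes f: "f \<in> iet" and one: "P \<one>\<^bsub>G\<^esub>"
    and step: "\<And>f u a b. f \<in> iet \<Longrightarrow> P f \<Longrightarrow> 0 \<le> u \<Longrightarrow> 0 \<le> a \<Longrightarrow> 0 \<le> b \<Longrightarrow> u + a + b \<le> 1 \<Longrightarrow>
      P (f \<otimes>\<^bsub>G\<^esub> iet_swap u a b)"
  shows "P f"
proof -
  have e: "exchange UNIV f" by (rule exchange_of_iet[OF f])
  obtain E where E: "finite E" "const_off E (\<lambda>x. f x - x)"
    using step_funE[OF exchangeD(2)[OF e]] by metis
  have "const_off (insert 1 E) (\<lambda>x. f x - x)"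
    using E(2) unfolding const_off_def by auto
  then have "P (iet_of f)"
    using E(1) by (intro exchange_decompose[of P f "insert 1 E" 0] one step e) auto
  then show ?thesis using restrict_iet[OF f] by simp
qed

section \<open>Rescaling and the abelianization\<close>

text \<open>The copy of \<open>f\<close> in the first of \<open>M\<close> blocks.\<close>

definition shrink :: "nat \<Rightarrow> (real \<Rightarrow> real) \<Rightarrow> real \<Rightarrow> real" where
  "shrink M f = block_iet M (\<lambda>i. if i = 0 then f else \<one>\<^bsub>G\<^esub>)"

lemma shrink_iet: "0 < M \<Longrightarrow> f \<in> iet \<Longrightarrow> shrink M f \<in> iet"
  unfolding shrink_def by (rule iet_blocks) auto

lemma shrink_mult:
  assumes "0 < M" "f \<in> iet" "g \<in> iet"
  shows "shrink M (f \<otimes>\<^bsub>G\<^esub> g) = shrink M f \<otimes>\<^bsub>G\<^esub> shrink M g"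
proof -
  have "shrink M f \<otimes>\<^bsub>G\<^esub> shrink M g =
      block_iet M (\<lambda>i. (if i = 0 then f else \<one>\<^bsub>G\<^esub>) \<otimes>\<^bsub>G\<^esub> (if i = 0 then g else \<one>\<^bsub>G\<^esub>))"
    unfolding shrink_def by (rule mult_blocks) (use assms in auto)
  also have "(\<lambda>i::nat. (if i = 0 then f else \<one>\<^bsub>G\<^esub>) \<otimes>\<^bsub>G\<^esub> (if i = 0 then g else \<one>\<^bsub>G\<^esub>)) =
      (\<lambda>i. if i = 0 then f \<otimes>\<^bsub>G\<^esub> g else \<one>\<^bsub>G\<^esub>)" by auto
  finally show ?thesis unfolding shrink_def by (rule sym)
qed

lemma shrink_apply:
  assumes "0 < M" "x \<in> unit_interval"
  shows "shrink M f x = (if x < 1 / real M then f (real M * x) / real M else x)"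
proof -
  obtain i y where iy: "i < M" "y \<in> unit_interval" "x = (y + real i) / real M"
    by (rule block_coords[OF assms])
  have "x < 1 / real M \<longleftrightarrow> y + real i < 1" using assms(1) unfolding iy(3)
    by (simp add: divide_less_cancel)
  also have "\<dots> \<longleftrightarrow> i = 0" using iy(2) by (cases i) auto
  finally have x: "x < 1 / real M \<longleftrightarrow> i = 0" .
  have M: "real M * x = y + real i" using assms(1) iy(3) by simp
  have "shrink M f x = blocks M (\<lambda>i. if i = 0 then f else \<one>\<^bsub>G\<^esub>) x"
    using assms(2) by (simp add: shrink_def)
  also have "\<dots> = ((if i = 0 then f else \<one>\<^bsub>G\<^esub>) y + real i) / real M"
    unfolding iy(3) blocks_at[OF assms(1) iy(2)] ..
  finally show ?thesis using x M iy(3) one_G_apply[OF iy(2)] by simp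
qed

lemma shrink_one: "0 < M \<Longrightarrow> shrink M \<one>\<^bsub>G\<^esub> = \<one>\<^bsub>G\<^esub>"
proof (rule iet_ext)
  assume M: "0 < M"
  show "shrink M \<one>\<^bsub>G\<^esub> \<in> iet" by (rule shrink_iet[OF M]) simp
  fix x assume x: "x \<in> unit_interval"
  have "real M * x \<in> unit_interval" if "x < 1 / real M" using that M x by (auto simp: field_simps)
  then show "shrink M \<one>\<^bsub>G\<^esub> x = \<one>\<^bsub>G\<^esub> x"
    unfolding shrink_apply[OF M x] using M by (auto simp: one_G_apply[OF x] one_G_apply)
qed simp

lemma shrink_shrink:
  assumes "0 < K" "0 < M" "f \<in> iet"
  shows "shrink K (shrink M f) = shrink (K * M) f"
proof (rule iet_ext)
  show "shrink K (shrink M f) \<in> iet" "shrink (K * M) f \<in> iet" using assms by (auto intro: shrink_iet)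
  fix x assume x: "x \<in> unit_interval"
  have lt: "x < 1 / real K" if "x < 1 / real (K * M)"
  proof -
    have "1 / real (K * M) \<le> 1 / real K" using assms by (intro divide_left_mono) auto
    then show ?thesis using that by simp
  qed
  show "shrink K (shrink M f) x = shrink (K * M) f x"
  proof (cases "x < 1 / real K")
    case True
    then have Kx: "real K * x \<in> unit_interval" using x assms by (auto simp: field_simps)
    have "real K * x < 1 / real M \<longleftrightarrow> x < 1 / real (K * M)" using assms by (auto simp: field_simps)
    then show ?thesis
      using True assms shrink_apply[OF assms(1) x, of "shrink M f"] shrink_apply[OF assms(2) Kx, of f]
        shrink_apply[of "K * M" x f] x by (auto simp: mult_ac)
  next
    case False
    then show ?thesis
      using lt assms shrink_apply[OF assms(1) x, of "shrink M f"] shrink_apply[of "K * M" x f] x by auto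
  qed
qed

lemma shrink_swap:
  assumes "0 < M" "0 \<le> u" "0 \<le> a" "0 \<le> b" "u + a + b \<le> 1"
  shows "shrink M (iet_swap u a b) = iet_swap (u / real M) (a / real M) (b / real M)"
proof (rule iet_ext)
  have le: "u / real M + a / real M + b / real M \<le> 1"
  proof -
    have "u + a + b \<le> real M" using assms(1,5) by linarith
    then show ?thesis using assms(1) by (simp add: add_divide_distrib[symmetric])
  qed
  show "shrink M (iet_swap u a b) \<in> iet" by (rule shrink_iet[OF assms(1) iet_swap_mem[OF assms(2-5)]])
  show "iet_swap (u / real M) (a / real M) (b / real M) \<in> iet" by (rule iet_swap_mem) (use assms le in auto)
  fix x assume x: "x \<in> unit_interval"
  show "shrink M (iet_swap u a b) x = iet_swap (u / real M) (a / real M) (b / real M) x"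
  proof (cases "x < 1 / real M")
    case True
    then have Mx: "real M * x \<in> unit_interval" using x assms by (auto simp: field_simps)
    have i: "u / real M \<le> x \<longleftrightarrow> u \<le> real M * x"
      "x < u / real M + a / real M \<longleftrightarrow> real M * x < u + a"
      "u / real M + a / real M \<le> x \<longleftrightarrow> u + a \<le> real M * x"
      "x < u / real M + a / real M + b / real M \<longleftrightarrow> real M * x < u + a + b"
      using assms(1) by (auto simp: field_simps)
    have "swap_intervals u a b (real M * x) / real M =
        swap_intervals (u / real M) (a / real M) (b / real M) x"
      unfolding swap_intervals_def i using assms(1) by (simp add: add_divide_distrib diff_divide_distrib)
    then show ?thesis using True Mx x shrink_apply[OF assms(1) x] by simp
  next
    case False
    have "0 \<le> b / real M" using assms(4) by simp
    moreover have "(u + a + b) / real M \<le> 1 / real M" using assms by (intro divide_right_mono) auto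
    ultimately have "\<not> x < u / real M + a / real M + b / real M" "\<not> x < u / real M + a / real M"
      using False by (auto simp: add_divide_distrib)
    then show ?thesis using False x shrink_apply[OF assms(1) x] by (simp add: swap_intervals_def)
  qed
qed

text \<open>The abelianization of the group of interval exchange transformations, and the class of an element in it.\<close>

definition iet_ab :: "(real \<Rightarrow> real) set monoid" where
  "iet_ab = G Mod derived G (carrier G)"

interpretation ab: comm_group iet_ab
  unfolding iet_ab_def by (rule G.derived_quot_is_comm_group)

definition cls :: "(real \<Rightarrow> real) \<Rightarrow> (real \<Rightarrow> real) set" where
  "cls f = derived G (carrier G) #>\<^bsub>G\<^esub> f"

lemma cls_hom: "cls \<in> hom G iet_ab"
  unfolding cls_def iet_ab_def by (rule normal.r_coset_hom_Mod[OF G.derived_self_is_normal])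

lemma cls_closed [simp]: "f \<in> iet \<Longrightarrow> cls f \<in> carrier iet_ab"
  using hom_in_carrier[OF cls_hom] by simp

lemma cls_mult: "f \<in> iet \<Longrightarrow> g \<in> iet \<Longrightarrow> cls (f \<otimes>\<^bsub>G\<^esub> g) = cls f \<otimes>\<^bsub>iet_ab\<^esub> cls g"
  using hom_mult[OF cls_hom] by simp

lemma cls_eq_one: "f \<in> iet \<Longrightarrow> cls f = \<one>\<^bsub>iet_ab\<^esub> \<longleftrightarrow> f \<in> derived G (carrier G)"
proof -
  assume f: "f \<in> iet"
  have sg: "subgroup (derived G (carrier G)) G" by (rule G.derived_is_subgroup) simp
  have "\<one>\<^bsub>iet_ab\<^esub> = derived G (carrier G)" by (simp add: iet_ab_def FactGroup_def)
  then show ?thesis unfolding cls_def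
    using G.coset_join1[OF _ _ sg] G.coset_join2[OF _ sg] f by auto
qed

text \<open>The class of a swap depends on the two lengths only, and additively on each of them. (It is not defined
  for all pairs of lengths, because the intervals have to fit into \<open>[0, 1)\<close>.)\<close>

lemma swap_class_position:
  assumes "0 \<le> u" "0 \<le> a" "0 \<le> b" "u + a + b \<le> 1"
  shows "cls (iet_swap u a b) = cls (iet_swap 0 a b)"
proof -
  have r: "exchange UNIV (swap_intervals 0 u (a + b))" by (rule exchange_swap) (use assms in auto)
  have s: "exchange UNIV (swap_intervals u a b)" by (rule exchange_swap) (use assms in auto)
  have s0: "exchange UNIV (swap_intervals 0 a b)" by (rule exchange_swap) (use assms in auto)
  have "iet_of (swap_intervals 0 u (a + b)) \<otimes>\<^bsub>G\<^esub> iet_swap u a b = iet_swap 0 a b \<otimes>\<^bsub>G\<^esub> iet_of (swap_intervals 0 u (a + b))"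
    unfolding mult_iet_of[OF r s] mult_iet_of[OF s0 r]
    by (rule restrict_ext) (use assms in \<open>auto simp: swap_intervals_def\<close>)
  then have "cls (iet_swap 0 u (a + b)) \<otimes>\<^bsub>iet_ab\<^esub> cls (iet_swap u a b) = cls (iet_swap 0 a b) \<otimes>\<^bsub>iet_ab\<^esub> cls (iet_swap 0 u (a + b))"
    using cls_mult[OF iet_restrict[OF r] iet_restrict[OF s]]
      cls_mult[OF iet_restrict[OF s0] iet_restrict[OF r]] by simp
  then show ?thesis
    using iet_restrict[OF r] iet_restrict[OF s] iet_restrict[OF s0] by (simp add: ab.m_comm)
qed

lemma swap_class_right:
  assumes "0 \<le> a" "0 \<le> b" "0 \<le> c" "a + b + c \<le> 1"
  shows "cls (iet_swap 0 a (b + c)) = cls (iet_swap 0 a b) \<otimes>\<^bsub>iet_ab\<^esub> cls (iet_swap 0 a c)"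
proof -
  have e: "exchange UNIV (swap_intervals b a c)" "exchange UNIV (swap_intervals 0 a b)"
    by (rule exchange_swap; use assms in simp)+
  have "iet_swap b a c \<otimes>\<^bsub>G\<^esub> iet_swap 0 a b = iet_swap 0 a (b + c)"
    unfolding mult_iet_of[OF e] by (rule restrict_ext) (use assms in \<open>auto simp: swap_intervals_def\<close>)
  then have "cls (iet_swap 0 a (b + c)) = cls (iet_swap b a c) \<otimes>\<^bsub>iet_ab\<^esub> cls (iet_swap 0 a b)"
    using cls_mult[OF iet_restrict[OF e(1)] iet_restrict[OF e(2)]] by simp
  moreover have "cls (iet_swap b a c) = cls (iet_swap 0 a c)" by (rule swap_class_position) (use assms in auto)
  moreover have "iet_swap 0 a b \<in> iet" "iet_swap 0 a c \<in> iet" by (rule iet_swap_mem; use assms in simp)+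
  ultimately show ?thesis by (simp add: ab.m_comm)
qed

lemma swap_class_left:
  assumes "0 \<le> a" "0 \<le> b" "0 \<le> c" "a + b + c \<le> 1"
  shows "cls (iet_swap 0 (a + b) c) = cls (iet_swap 0 a c) \<otimes>\<^bsub>iet_ab\<^esub> cls (iet_swap 0 b c)"
proof -
  have e: "exchange UNIV (swap_intervals 0 a c)" "exchange UNIV (swap_intervals a b c)"
    by (rule exchange_swap; use assms in simp)+
  have "iet_swap 0 a c \<otimes>\<^bsub>G\<^esub> iet_swap a b c = iet_swap 0 (a + b) c"
    unfolding mult_iet_of[OF e] by (rule restrict_ext) (use assms in \<open>auto simp: swap_intervals_def\<close>)
  then have "cls (iet_swap 0 (a + b) c) = cls (iet_swap 0 a c) \<otimes>\<^bsub>iet_ab\<^esub> cls (iet_swap a b c)"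
    using cls_mult[OF iet_restrict[OF e(1)] iet_restrict[OF e(2)]] by simp
  moreover have "cls (iet_swap a b c) = cls (iet_swap 0 b c)" by (rule swap_class_position) (use assms in auto)
  ultimately show ?thesis by simp
qed

text \<open>The fourth power in the abelianization.\<close>

definition quad :: "(real \<Rightarrow> real) set \<Rightarrow> (real \<Rightarrow> real) set" where
  "quad x = (x \<otimes>\<^bsub>iet_ab\<^esub> x) \<otimes>\<^bsub>iet_ab\<^esub> (x \<otimes>\<^bsub>iet_ab\<^esub> x)"

lemma quad_mult: "x \<in> carrier iet_ab \<Longrightarrow> y \<in> carrier iet_ab \<Longrightarrow> quad (x \<otimes>\<^bsub>iet_ab\<^esub> y) = quad x \<otimes>\<^bsub>iet_ab\<^esub> quad y"
  unfolding quad_def by (simp add: ab.m_ac)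

text \<open>For swaps this follows from the additivity of the class in both lengths, and swaps generate.\<close>

lemma cls_shrink: "f \<in> iet \<Longrightarrow> cls f = quad (cls (shrink 2 f))"
proof (induction rule: iet_swap_induct)
  case one
  have "cls \<one>\<^bsub>G\<^esub> = \<one>\<^bsub>iet_ab\<^esub>" using hom_one[OF cls_hom G.group_axioms ab.group_axioms] .
  then show ?case by (simp add: shrink_one quad_def)
next
  case (swap f u a b)
  let ?a = "a / 2" and ?b = "b / 2"
  have s: "iet_swap u a b \<in> iet" by (rule iet_swap_mem) (use swap in auto)
  have i: "iet_swap 0 ?a ?b \<in> iet" by (rule iet_swap_mem) (use swap in auto)
  have "cls (iet_swap u a b) = cls (iet_swap 0 (?a + ?a) (?b + ?b))"
    using swap_class_position[of u a b] swap by simp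
  also have "\<dots> = cls (iet_swap 0 ?a (?b + ?b)) \<otimes>\<^bsub>iet_ab\<^esub> cls (iet_swap 0 ?a (?b + ?b))"
    by (rule swap_class_left) (use swap in auto)
  also have "cls (iet_swap 0 ?a (?b + ?b)) = cls (iet_swap 0 ?a ?b) \<otimes>\<^bsub>iet_ab\<^esub> cls (iet_swap 0 ?a ?b)"
    by (rule swap_class_right) (use swap in auto)
  also have "cls (iet_swap 0 ?a ?b) = cls (iet_swap (u / 2) ?a ?b)"
    by (rule swap_class_position[symmetric]) (use swap in auto)
  also have "iet_swap (u / 2) ?a ?b = shrink 2 (iet_swap u a b)" using shrink_swap[of 2 u a b] swap by simp
  finally have c: "cls (iet_swap u a b) = quad (cls (shrink 2 (iet_swap u a b)))" unfolding quad_def .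
  have sh: "shrink 2 f \<in> iet" "shrink 2 (iet_swap u a b) \<in> iet" using swap(1) s by (auto intro: shrink_iet)
  have "cls (f \<otimes>\<^bsub>G\<^esub> iet_swap u a b) = quad (cls (shrink 2 f)) \<otimes>\<^bsub>iet_ab\<^esub> quad (cls (shrink 2 (iet_swap u a b)))"
    using cls_mult[OF swap(1) s] c swap.IH by simp
  also have "\<dots> = quad (cls (shrink 2 f) \<otimes>\<^bsub>iet_ab\<^esub> cls (shrink 2 (iet_swap u a b)))"
    using sh by (simp add: quad_mult)
  also have "\<dots> = quad (cls (shrink 2 (f \<otimes>\<^bsub>G\<^esub> iet_swap u a b)))"
    using shrink_mult[OF _ swap(1) s, of 2] cls_mult[OF sh] by simp
  finally show ?case .
qed

lemma derived_of_shrink: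
  assumes "f \<in> iet" "shrink (2 ^ m) f \<in> derived G (carrier G)"
  shows "f \<in> derived G (carrier G)"
  using assms(2)
proof (induction m)
  case 0
  have "shrink (2 ^ 0) f = f"
    by (rule iet_ext) (use assms(1) shrink_iet shrink_apply[of 1] in auto)
  then show ?case using 0 by simp
next
  case (Suc m)
  let ?h = "shrink (2 ^ m) f"
  have h: "?h \<in> iet" by (rule shrink_iet) (use assms in auto)
  have "shrink 2 ?h \<in> derived G (carrier G)"
    using Suc.prems shrink_shrink[of 2 "2 ^ m" f] assms(1) by simp
  then have "cls (shrink 2 ?h) = \<one>\<^bsub>iet_ab\<^esub>" using cls_eq_one[OF shrink_iet[OF _ h, of 2]] by simp
  then have "cls ?h = \<one>\<^bsub>iet_ab\<^esub>" using cls_shrink[OF h] by (simp add: quad_def)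
  then show ?case using cls_eq_one[OF h] Suc.IH by simp
qed

section \<open>Amplification and uniform perfectness\<close>

lemma (in unit_subgroup) BP_subset:
  assumes f: "exchange D f"
  shows "BP f \<subseteq> D"
proof -
  obtain E where E: "finite E" "E \<subseteq> D" "const_off E (\<lambda>x. f x - x)"
    using exchangeD(2)[OF f] by (rule step_funE)
  have "continuous (at x within unit_interval) f" if x: "x \<in> unit_interval" "x \<notin> D" for x
  proof -
    obtain d where d: "0 < d" "\<forall>e\<in>E. e \<noteq> x \<longrightarrow> d \<le> dist x e"
      using finite_set_avoid[OF E(1), of x] by blast
    have far: "d \<le> dist x e" if "e \<in> E" for e using d(2) that x(2) E(2) by auto
    show ?thesis
    proof (rule continuous_transform_within[OF _ d(1) x(1)])
      show "continuous (at x within unit_interval) (\<lambda>y. y + (f x - x))"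
        by (intro continuous_intros)
      fix y assume y: "y \<in> unit_interval" "dist y x < d"
      have "E \<inter> {min x y<..max x y} = {}"
      proof (rule ccontr)
        assume "\<not> ?thesis"
        then obtain e where "e \<in> E" "min x y < e" "e \<le> max x y" by auto
        then show False using far[of e] y(2) by (auto simp: dist_real_def)
      qed
      then have "f (min x y) - min x y = f (max x y) - max x y"
        using x(1) y(1) by (intro const_offD[OF E(3)]) auto
      then show "y + (f x - x) = f y" by (auto simp: min_def max_def split: if_splits)
    qed
  qed
  then show ?thesis unfolding BP_def using zero_mem by blast
qed

lemma unit_subgroup_Delta: "unit_subgroup (Delta p \<alpha>)"
  unfolding Delta_def
  by unfold_locales (auto intro: group_closure.base group_closure.diff)

lemma (in unit_subgroup) of_int_mem: "of_int n \<in> D"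
proof (cases "0 \<le> n")
  case True
  then show ?thesis using of_nat_mult_mem[OF one_mem, of "nat n"] by simp
next
  case False
  then show ?thesis using minus_mem[OF of_nat_mult_mem[OF one_mem, of "nat (- n)"]] by simp
qed

lemma (in unit_subgroup) mem_of_frac: "frac x \<in> D \<Longrightarrow> x \<in> D"
  using add_mem[OF _ of_int_mem, of "frac x" "\<lfloor>x\<rfloor>"] by (simp add: frac_def)

text \<open>The powers of \<open>sqrt 2 - 1\<close> tend to \<open>0\<close> and are integral linear combinations of \<open>1\<close> and \<open>sqrt 2 - 1\<close>.\<close>

lemma (in unit_subgroup) dense_of_sqrt2:
  assumes s: "sqrt 2 - 1 \<in> D" and \<epsilon>: "0 < \<epsilon>"
  shows "\<exists>d\<in>D. 0 < d \<and> d < \<epsilon>"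
proof -
  have pow: "\<exists>a b :: int. (sqrt 2 - 1) ^ n = of_int a + of_int b * (sqrt 2 - 1)" for n
  proof (induction n)
    case 0
    show ?case by (intro exI[of _ 1] exI[of _ 0]) simp
  next
    case (Suc n)
    then obtain a b :: int where ab: "(sqrt 2 - 1) ^ n = of_int a + of_int b * (sqrt 2 - 1)"
      by blast
    have sq: "(sqrt 2 - 1) * (sqrt 2 - 1) = 1 - 2 * (sqrt 2 - 1)" by (simp add: algebra_simps)
    have "(sqrt 2 - 1) ^ Suc n = of_int a * (sqrt 2 - 1) + of_int b * ((sqrt 2 - 1) * (sqrt 2 - 1))"
      unfolding power_Suc2 ab by (simp only: distrib_right mult.assoc)
    also have "\<dots> = of_int b + of_int (a - 2 * b) * (sqrt 2 - 1)"
      unfolding sq by (simp add: algebra_simps)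
    finally have "(sqrt 2 - 1) ^ Suc n = of_int b + of_int (a - 2 * b) * (sqrt 2 - 1)" .
    then show ?case by blast
  qed
  have mult: "of_int b * x \<in> D" if "x \<in> D" for b x
  proof (cases "0 \<le> b")
    case True
    then show ?thesis using of_nat_mult_mem[OF that, of "nat b"] by simp
  next
    case False
    then show ?thesis using minus_mem[OF of_nat_mult_mem[OF that, of "nat (- b)"]] by simp
  qed
  have "(sqrt 2 - 1) ^ n \<in> D" for n
  proof -
    obtain a b :: int where "(sqrt 2 - 1) ^ n = of_int a + of_int b * (sqrt 2 - 1)"
      using pow[of n] by blast
    then show ?thesis using add_mem[OF of_int_mem mult[OF s]] by simp
  qed
  moreover have lt: "0 < sqrt 2 - 1" "sqrt 2 - 1 < 1" using sqrt2_less_2 by auto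
  moreover obtain n where "(sqrt 2 - 1) ^ n < \<epsilon>" using real_arch_pow_inv[OF \<epsilon> lt(2)] by blast
  ultimately show ?thesis by (intro bexI[of _ "(sqrt 2 - 1) ^ n"]) auto
qed

text \<open>The rescaling of an exchange supported in \<open>[0, 1 / M)\<close> to \<open>[0, 1)\<close>. Breakpoints stay in \<open>D\<close>, as they are
  multiplied by the integer \<open>M\<close>.\<close>

lemma (in unit_subgroup) exchange_magnify:
  assumes q: "exchange D q" and M: "0 < M"
    and fix_q: "\<And>x. 1 / real M \<le> x \<Longrightarrow> x < 1 \<Longrightarrow> q x = x"
  shows "exchange D (\<lambda>x. real M * q (x / real M))"
  unfolding exchange_def
proof (intro conjI ballI)
  have small: "x / real M \<in> unit_interval" "x / real M < 1 / real M" if "x \<in> unit_interval" for x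
  proof -
    show "x / real M < 1 / real M" using that M by (intro divide_strict_right_mono) auto
    moreover have "1 / real M \<le> 1" using M by simp
    ultimately show "x / real M \<in> unit_interval" using that by auto
  qed
  have q_small: "q x < 1 / real M" if "x \<in> unit_interval" "x < 1 / real M" for x
  proof (rule ccontr)
    assume a: "\<not> ?thesis"
    have qx: "q x \<in> unit_interval" by (rule exchange_mem[OF q that(1)])
    have "q (q x) = q x" using fix_q[of "q x"] a qx by simp
    then have "q x = x" by (rule exchange_inj[OF q qx that(1)])
    then show False using a that(2) by simp
  qed
  have mem: "real M * q (x / real M) \<in> unit_interval" if x: "x \<in> unit_interval" for x
    using q_small[OF small[OF x]] exchange_mem[OF q small(1)[OF x]] M by (simp add: field_simps)
  show "bij_betw (\<lambda>x. real M * q (x / real M)) unit_interval unit_interval"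
    unfolding bij_betw_def
  proof
    show "inj_on (\<lambda>x. real M * q (x / real M)) unit_interval"
    proof (rule inj_onI)
      fix x y assume x: "x \<in> unit_interval" and y: "y \<in> unit_interval"
        and "real M * q (x / real M) = real M * q (y / real M)"
      then have "q (x / real M) = q (y / real M)" using M by simp
      then have "x / real M = y / real M" by (rule exchange_inj[OF q small(1)[OF x] small(1)[OF y]])
      then show "x = y" using M by simp
    qed
    show "(\<lambda>x. real M * q (x / real M)) ` unit_interval = unit_interval"
    proof (intro equalityI subsetI)
      fix y assume "y \<in> (\<lambda>x. real M * q (x / real M)) ` unit_interval"
      then show "y \<in> unit_interval" using mem by blast
    next
      fix y assume y: "y \<in> unit_interval"
      obtain x where x: "x \<in> unit_interval" "q x = y / real M"
        by (rule exchange_surj[OF q small(1)[OF y]])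
      have "x < 1 / real M" using fix_q[of x] x small(2)[OF y] by force
      then have "real M * x \<in> unit_interval" using x(1) M by (simp add: field_simps)
      moreover have "y = real M * q (real M * x / real M)" using x(2) M by simp
      ultimately show "y \<in> (\<lambda>x. real M * q (x / real M)) ` unit_interval" by blast
    qed
  qed
  obtain E where E: "finite E" "E \<subseteq> D" "const_off E (\<lambda>x. q x - x)"
    using exchangeD(2)[OF q] by (rule step_funE)
  have eq: "real M * q (x / real M) - x = real M * (q (x / real M) - x / real M)" for x
    using M by (simp add: right_diff_distrib)
  show "step_fun D (\<lambda>x. real M * q (x / real M) - x)"
  proof (rule step_funI[of "(\<lambda>e. real M * e) ` E"])
    show "(\<lambda>e. real M * e) ` E \<subseteq> D" using E(2) of_nat_mult_mem by blast
    fix x y :: real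
    assume xy: "0 \<le> x" "x \<le> y" "y < 1" "(\<lambda>e. real M * e) ` E \<inter> {x<..y} = {}"
    have "E \<inter> {x / real M<..y / real M} = {}"
    proof (rule ccontr)
      assume "\<not> ?thesis"
      then obtain e where e: "e \<in> E" "x / real M < e" "e \<le> y / real M" by auto
      then have "real M * e \<in> {x<..y}" using M by (simp add: field_simps)
      then show False using e(1) xy(4) by blast
    qed
    then have "q (x / real M) - x / real M = q (y / real M) - y / real M"
      using small[of x] small[of y] xy M
      by (intro const_offD[OF E(3)]) (auto simp: divide_right_mono)
    then show "real M * q (x / real M) - x = real M * q (y / real M) - y" unfolding eq by simp
  qed (use E(1) in simp)
  fix x assume "x \<in> unit_interval"
  then show "real M * q (x / real M) - x \<in> D"
    unfolding eq using exchangeD(3)[OF q small(1)] of_nat_mult_mem by blast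
qed

text \<open>The number three does not depend on the bound \<open>C\<close>; the bound enters only through the scale \<open>1 / M\<close>.\<close>

theorem (in unit_subgroup) three_commutators:
  assumes dense: "\<And>\<epsilon>. 0 < \<epsilon> \<Longrightarrow> \<exists>d\<in>D. 0 < d \<and> d < \<epsilon>"
    and bound: "\<And>f. f \<in> derived G (carrier G) \<Longrightarrow> exchange D f \<Longrightarrow> commutator_length G f \<le> C"
    and g: "exchange D g" "g \<in> derived G (carrier G)"
  shows "product_of_commutators G 3 g"
proof -
  have UN: "exchange UNIV f" if "exchange D f" for f by (rule exchange_mono[OF that]) simp
  define M :: nat where "M = 2 ^ C"
  have M: "0 < M" "C < M" by (simp_all add: M_def)
  obtain J r p where J: "step_fun D (\<lambda>x. x \<in> J)" "J \<subseteq> unit_interval"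
    and dis: "\<forall>x\<in>J. \<forall>i\<in>{1..M - 1}. (g ^^ i) x \<notin> J"
    and r: "exchange D r" "\<forall>x. x \<notin> J \<longrightarrow> r x = x"
    and p: "finite_order_exchange p (fact (2 * (M - 1) + 1))"
    and dec: "\<forall>x\<in>unit_interval. g x = r (p x)"
    by (rule split_off_finite_order[OF dense g(1)])
  have derG: "derived G (carrier G) \<subseteq> iet" using G.derived_in_carrier[of "carrier G"] by simp
  have sg: "subgroup (derived G (carrier G)) G" by (rule G.derived_is_subgroup) simp
  have gI: "g \<in> iet" using derG g(2) by blast
  have rI: "iet_of r \<in> iet" by (rule iet_restrict[OF UN[OF r(1)]])
  have pE: "exchange UNIV p" by (rule finite_order_exchange.p[OF p])
  have pI: "iet_of p \<in> iet" by (rule iet_restrict[OF pE])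
  have pc: "iet_of p \<in> derived_set G (carrier G)"
    by (rule finite_order_exchange.finite_order_is_commutator[OF p])
  then have pd: "iet_of p \<in> derived G (carrier G)" unfolding derived_def by (rule generate.incl)
  have "iet_of (\<lambda>x. r (p x)) = iet_of g" by (rule restrict_ext) (simp add: dec)
  then have grp: "g = iet_of r \<otimes>\<^bsub>G\<^esub> iet_of p"
    unfolding mult_iet_of[OF UN[OF r(1)] pE] restrict_iet[OF gI] by (rule sym)
  have "iet_of r = g \<otimes>\<^bsub>G\<^esub> inv\<^bsub>G\<^esub> (iet_of p)"
    unfolding grp using rI pI by (simp add: G.m_assoc)
  then have rd: "iet_of r \<in> derived G (carrier G)"
    using subgroup.m_closed[OF sg g(2) subgroup.m_inv_closed[OF sg pd]] by simp
  obtain f t where f: "exchange D f" and t: "t \<in> D" "0 \<le> t" "t \<le> 1"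
    "\<forall>x\<in>unit_interval. x \<in> J \<longleftrightarrow> f x < t" by (rule collect[OF J(1)])
  have JU: "step_fun UNIV (\<lambda>x. x \<in> J)" by (rule step_fun_mono[OF J(1)]) simp
  have "real (Suc (M - 1)) * measure lebesgue J \<le> 1"
    by (rule disjoint_images_measure[OF UN[OF g(1)] JU J(2) dis])
  moreover have "measure lebesgue J = t" by (rule collected_length[OF UN[OF f] JU J(2) t(2-4)])
  ultimately have tM: "t \<le> 1 / real M" using M by (simp add: field_simps)
  obtain h where h: "exchange D h" "\<And>x. x \<in> unit_interval \<Longrightarrow> f (h x) = x"
    "\<And>x. x \<in> unit_interval \<Longrightarrow> h (f x) = x"
    using exchange_inverse_exists[OF f] by metis
  define q where "q = (\<lambda>x. f (r (h x)))"
  have rh: "exchange D (\<lambda>x. r (h x))" by (rule exchange_compose[OF r(1) h(1)])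
  have q: "exchange D q" unfolding q_def by (rule exchange_compose[OF f rh])
  have fix_q: "q x = x" if "1 / real M \<le> x" "x < 1" for x
  proof -
    have x: "x \<in> unit_interval" using that order_trans[of 0 "1 / real M" x] by simp
    have "h x \<notin> J" using t(4) exchange_mem[OF h(1) x] h(2)[OF x] that(1) tM by auto
    then show ?thesis using r(2) h(2)[OF x] by (simp add: q_def)
  qed
  have fI: "iet_of f \<in> iet" by (rule iet_restrict[OF UN[OF f]])
  have hI: "iet_of h \<in> iet" by (rule iet_restrict[OF UN[OF h(1)]])
  have "iet_of h \<otimes>\<^bsub>G\<^esub> iet_of f = \<one>\<^bsub>G\<^esub>"
    unfolding mult_iet_of[OF UN[OF h(1)] UN[OF f]] one_G by (rule restrict_ext) (rule h(3))
  then have hf: "iet_of h = inv\<^bsub>G\<^esub> (iet_of f)" using G.inv_equality[of "iet_of h" "iet_of f"] fI hI by simp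
  have "iet_of q = iet_of f \<otimes>\<^bsub>G\<^esub> (iet_of r \<otimes>\<^bsub>G\<^esub> iet_of h)"
    unfolding q_def mult_iet_of[OF UN[OF r(1)] UN[OF h(1)]] mult_iet_of[OF UN[OF f] UN[OF rh]] ..
  then have conj: "iet_of q = iet_of f \<otimes>\<^bsub>G\<^esub> iet_of r \<otimes>\<^bsub>G\<^esub> inv\<^bsub>G\<^esub> (iet_of f)"
    using fI rI hI by (simp add: G.m_assoc hf)
  then have qd: "iet_of q \<in> derived G (carrier G)"
    using normal.inv_op_closed2[OF G.derived_self_is_normal _ rd, of "iet_of f"] fI by simp
  define F where "F = iet_of (\<lambda>x. real M * q (x / real M))"
  have magn: "exchange D (\<lambda>x. real M * q (x / real M))" by (rule exchange_magnify[OF q M(1) fix_q])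
  have FI: "F \<in> iet" unfolding F_def by (rule iet_restrict[OF UN[OF magn]])
  have FD: "exchange D F" unfolding F_def by (rule exchange_cong[OF magn]) simp
  have qI: "iet_of q \<in> iet" by (rule iet_restrict[OF UN[OF q]])
  have shr: "shrink M F = iet_of q"
  proof (rule iet_ext[OF shrink_iet[OF M(1) FI] qI])
    fix x assume x: "x \<in> unit_interval"
    show "shrink M F x = iet_of q x"
    proof (cases "x < 1 / real M")
      case True
      then have "real M * x \<in> unit_interval" using x M by (simp add: field_simps)
      then show ?thesis using True x M unfolding shrink_apply[OF M(1) x] F_def by simp
    next
      case False
      then show ?thesis using fix_q[of x] x unfolding shrink_apply[OF M(1) x] by simp
    qed
  qed
  have Fd: "F \<in> derived G (carrier G)"
    by (rule derived_of_shrink[OF FI, of C]) (use qd shr in \<open>simp add: M_def\<close>)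
  have "product_of_commutators G (commutator_length G F) F"
    by (rule G.product_of_commutators_commutator_length[OF Fd])
  then obtain ks where len: "length ks = commutator_length G F"
    and ks: "set ks \<subseteq> derived_set G (carrier G)" "F = foldr (\<lambda>x y. x \<otimes>\<^bsub>G\<^esub> y) ks \<one>\<^bsub>G\<^esub>"
    unfolding product_of_commutators_def by (elim exE conjE)
  have lt: "length ks < M" unfolding len using bound[OF Fd FD] M(2) by simp
  have "product_of_commutators G 2 (iet_of q)"
    using first_block_two_commutators[OF ks(1) lt] unfolding ks(2)[symmetric] shrink_def[symmetric] shr .
  moreover have "inv\<^bsub>G\<^esub> (iet_of f) \<in> carrier G" using fI by simp
  ultimately have "product_of_commutators G 2
      (inv\<^bsub>G\<^esub> (iet_of f) \<otimes>\<^bsub>G\<^esub> iet_of q \<otimes>\<^bsub>G\<^esub> inv\<^bsub>G\<^esub> (inv\<^bsub>G\<^esub> (iet_of f)))"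
    by (rule G.product_of_commutators_conj)
  moreover have "inv\<^bsub>G\<^esub> (iet_of f) \<otimes>\<^bsub>G\<^esub> iet_of q \<otimes>\<^bsub>G\<^esub> inv\<^bsub>G\<^esub> (inv\<^bsub>G\<^esub> (iet_of f)) = iet_of r"
  proof -
    have "inv\<^bsub>G\<^esub> (iet_of f) \<otimes>\<^bsub>G\<^esub> (iet_of f \<otimes>\<^bsub>G\<^esub> iet_of r) = iet_of r"
      using fI rI by (simp flip: G.m_assoc)
    then show ?thesis unfolding conj using fI rI by (simp add: G.m_assoc)
  qed
  ultimately have "product_of_commutators G 2 (iet_of r)" by simp
  from G.product_of_commutators_mult[OF this G.product_of_commutators_one[OF pc]]
  show ?thesis unfolding grp by simp
qed

theorem theorem4:
  assumes "iet_partial_uniform_perfectness"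
  shows "uniformly_perfect iet_group"
proof -
  have "commutator_length G g \<le> 3" if g: "g \<in> derived G (carrier G)" for g
  proof -
    have gI: "g \<in> iet" using G.derived_in_carrier[of "carrier G"] g by auto
    have gE: "exchange UNIV g" by (rule exchange_of_iet[OF gI])
    obtain E where E: "finite E" "const_off E (\<lambda>x. g x - x)"
      using step_funE[OF exchangeD(2)[OF gE]] by metis
    define B where "B = insert (sqrt 2 - 1) (frac ` (E \<union> (\<lambda>x. g x - x) ` unit_interval))"
    have "finite ((\<lambda>x. g x - x) ` unit_interval)"
      by (rule step_fun_finite_range[OF exchangeD(2)[OF gE]])
    then have finB: "finite B" unfolding B_def using E(1) by simp
    have BI: "B \<subseteq> {0..<1}" unfolding B_def using sqrt2_less_2 by (auto simp: frac_lt_1)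
    define p where "p = card B"
    have "B \<noteq> {}" unfolding B_def by simp
    then have p: "1 \<le> p" unfolding p_def using finB by (simp add: Suc_le_eq card_gt_0_iff)
    obtain \<alpha> where "bij_betw \<alpha> {1..p} B"
      using ex_bij_betw_nat_finite_1[OF finB] unfolding p_def by blast
    then have \<alpha>: "\<alpha> ` {1..p} = B" by (rule bij_betw_imp_surj_on)
    define D where "D = Delta p \<alpha>"
    interpret D: unit_subgroup D unfolding D_def by (rule unit_subgroup_Delta)
    have BD: "x \<in> D" if "x \<in> B" for x
      unfolding D_def Delta_def using that \<alpha> by (intro group_closure.base) blast
    have ED: "E \<subseteq> D" using BD D.mem_of_frac unfolding B_def by blast
    have VD: "g x - x \<in> D" if "x \<in> unit_interval" for x
      using BD[of "frac (g x - x)"] D.mem_of_frac that unfolding B_def by blast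
    have "step_fun D (\<lambda>x. g x - x)" unfolding step_fun_def using E ED by blast
    then have gD: "exchange D g" unfolding exchange_def using exchangeD(1)[OF gE] VD by blast
    have "\<forall>i\<in>{1..p}. \<alpha> i \<in> {0..<1}" using \<alpha> BI by blast
    then have "partial_commutator_width p \<alpha> < \<infinity>"
      using assms p unfolding iet_partial_uniform_perfectness_def by blast
    then obtain C where C: "partial_commutator_width p \<alpha> = enat C" by (cases "partial_commutator_width p \<alpha>") auto
    have "commutator_length G f \<le> C" if f: "f \<in> derived G (carrier G)" "exchange D f" for f
    proof -
      have "f \<in> carrier G" using G.derived_in_carrier[of "carrier G"] f(1) by blast
      then have "f \<in> derived G (carrier G) \<inter> Defs.Gamma p \<alpha>"
        using f(1) D.BP_subset[OF f(2)] unfolding Defs.Gamma_def D_def by blast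
      then have "enat (commutator_length G f) \<le> partial_commutator_width p \<alpha>"
        unfolding partial_commutator_width_def by (rule SUP_upper)
      then show ?thesis using C by simp
    qed
    then have "product_of_commutators G 3 g"
      by (intro D.three_commutators[OF D.dense_of_sqrt2 _ gD g] BD) (simp_all add: B_def)
    then show ?thesis by (rule G.commutator_length_le)
  qed
  then have "commutator_width G \<le> enat 3"
    unfolding commutator_width_def by (intro SUP_least) (simp add: enat_ord_simps)
  then show ?thesis unfolding uniformly_perfect_def by (rule order_le_less_trans) simp
qed

end
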